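(* Let $\lambda\in k$, let $(\mathfrak g,[\cdot,\cdot,\cdot],d_{\mathfrak g})$ be a differential 3-Lie algebra with weight $\lambda$ and let $(V,\rho,d_V)$ be a representation of it. For $p\ge 2$ put $C_{3-D_\lambda}^{p}(\mathfrak g,V)=C_{3-\mathrm{Lie}}^{p}(\mathfrak g,V)\times C_{3-\mathrm{DLie}}^{p-1}(d_{\mathfrak g},d_V)$ and put $C_{3-D_\lambda}^{1}(\mathfrak g,V)=\mathrm{Hom}(\mathfrak g,V)$. Define $\partial_{D_\lambda}:C_{3-D_\lambda}^{p}(\mathfrak g,V)\to C_{3-D_\lambda}^{p+1}(\mathfrak g,V)$ by $\partial_{D_\lambda}(f,g)=(\partial f,\ \partial_\lambda g+(-1)^p\delta f)$ for $p\ge2$ and $\partial_{D_\lambda}(f)=(\partial f,-\delta f)$ for $p=1$. Then $\partial_{D_\lambda}$ is a coboundary operator, that is, $\partial_{D_\lambda}\partial_{D_\lambda}=0$.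
   Context: $k$ is a field of characteristic 0; all vector spaces are over $k$. A 3-Lie algebra is a vector space $\mathfrak g$ with a skew-symmetric trilinear bracket satisfying $[x_1,x_2,[y_1,y_2,y_3]]=[[x_1,x_2,y_1],y_2,y_3]+[y_1,[x_1,x_2,y_2],y_3]+[y_1,y_2,[x_1,x_2,y_3]]$. A differential 3-Lie algebra with weight $\lambda$ is a 3-Lie algebra with a linear map $d=d_{\mathfrak g}:\mathfrak g\to\mathfrak g$ such that $d[x_1,x_2,x_3]=[dx_1,x_2,x_3]+[x_1,dx_2,x_3]+[x_1,x_2,dx_3]+\lambda[dx_1,dx_2,x_3]+\lambda[x_1,dx_2,dx_3]+\lambda[dx_1,x_2,dx_3]+\lambda^2[dx_1,dx_2,dx_3]$. A representation of a 3-Lie algebra $\mathfrak g$ is a vector space $V$ with a skew-symmetric bilinear map $\rho:\mathfrak g\wedge\mathfrak g\to gl(V)$ such that $\rho(x_1,x_2)\rho(x_3,x_4)=\rho([x_1,x_2,x_3],x_4)+\rho(x_3,[x_1,x_2,x_4])+\rho(x_3,x_4)\rho(x_1,x_2)$ and $\rho(x_1,[x_2,x_3,x_4])=\rho(x_3,x_4)\rho(x_1,x_2)-\rho(x_2,x_4)\rho(x_1,x_3)+\rho(x_2,x_3)\rho(x_1,x_4)$. A representation $(V,\rho,d_V)$ of $(\mathfrak g,d)$ has in addition a linear $d_V:V\to V$ with $d_V\rho(x_1,x_2)=\rho(dx_1,x_2)+\rho(x_1,dx_2)+\lambda\rho(dx_1,dx_2)+\rho(x_1,x_2)d_V+\lambda(\rho(dx_1,x_2)+\rho(x_1,dx_2)+\lambda\rho(dx_1,dx_2))d_V$.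 Put $\hat\rho(x_1,x_2)=\rho(x_1,x_2)+\lambda(\rho(dx_1,x_2)+\rho(x_1,dx_2)+\lambda\rho(dx_1,dx_2))$. Let $L=\wedge^2\mathfrak g$ with $[X,Y]_F=y_1\wedge[x_1,x_2,y_2]+[x_1,x_2,y_1]\wedge y_2$ for $X=x_1\wedge x_2$, $Y=y_1\wedge y_2$. For $X=x\wedge y$ write $[X,z]=[x,y,z]$, $\rho(X)=\rho(x,y)$. Cochains: $C^1_{3-\mathrm{Lie}}(\mathfrak g,V)=\mathrm{Hom}(\mathfrak g,V)$; for $p\ge2$, $C^p_{3-\mathrm{Lie}}(\mathfrak g,V)$ is the space of multilinear maps $f(X_1,\dots,X_{p-1},z)$ in $X_1,\dots,X_{p-1}\in L$, $z\in\mathfrak g$, which are totally skew-symmetric in the last three entries $x_{p-1},y_{p-1},z$ (where $X_{p-1}=x_{p-1}\wedge y_{p-1}$). As vector spaces $C^p_{3-\mathrm{DLie}}(d_{\mathfrak g},d_V)=C^p_{3-\mathrm{Lie}}(\mathfrak g,V)$. For $X_i=x_i\wedge y_i$, the map $\partial:C^p_{3-\mathrm{Lie}}\to C^{p+1}_{3-\mathrm{Lie}}$ is $(\partial f)(X_1,\dots,X_p,z)=\sum_{1\le i<j\le p}(-1)^i f(X_1,\dots,\hat X_i,\dots,X_{j-1},[X_i,X_j]_F,X_{j+1},\dots,X_p,z)+\sum_{i=1}^p(-1)^i f(X_1,\dots,\hat X_i,\dots,X_p,[X_i,z])+\sum_{i=1}^p(-1)^{i+1}\rho(X_i)f(X_1,\dots,\hat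 X_i,\dots,X_p,z)+(-1)^{p+1}\big(\rho(y_p,z)f(X_1,\dots,X_{p-1},x_p)+\rho(z,x_p)f(X_1,\dots,X_{p-1},y_p)\big)$, and $\partial_\lambda:C^p_{3-\mathrm{DLie}}\to C^{p+1}_{3-\mathrm{DLie}}$ is given by the same formula with $\rho$ replaced by $\hat\rho$. The map $\delta:C^p_{3-\mathrm{Lie}}(\mathfrak g,V)\to C^p_{3-\mathrm{DLie}}(d_{\mathfrak g},d_V)$ is $\delta f=\sum_{k=1}^{2p-1}\lambda^{k-1}f^k-d_V f$, where, viewing $f$ as a function of the $2p-1$ elements $x_1,y_1,\dots,x_{p-1},y_{p-1},z$ of $\mathfrak g$, $f^k$ is the sum over all choices of $k$ of these entries of $f$ with $d_{\mathfrak g}$ applied to exactly the chosen entries. *)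

theory Defs
  imports Complex_Main "HOL-Library.Poly_Mapping"
begin

section \<open>Differential 3-Lie algebras and their representations\<close>

locale three_lie_algebra = vector_space sg
  for sg :: "'k::field_char_0 \<Rightarrow> 'g::ab_group_add \<Rightarrow> 'g" +
  fixes br :: "'g \<Rightarrow> 'g \<Rightarrow> 'g \<Rightarrow> 'g"
  assumes br_linear1: "Vector_Spaces.linear sg sg (\<lambda>x. br x y z)"
    and br_linear2: "Vector_Spaces.linear sg sg (\<lambda>y. br x y z)"
    and br_linear3: "Vector_Spaces.linear sg sg (\<lambda>z. br x y z)"
    and br_skew12: "br y x z = - br x y z"
    and br_skew23: "br x z y = - br x y z"
    and br_fundamental: "br x1 x2 (br y1 y2 y3) =
      br (br x1 x2 y1) y2 y3 + br y1 (br x1 x2 y2) y3 + br y1 y2 (br x1 x2 y3)"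

locale diff_three_lie_algebra = three_lie_algebra sg br
  for sg :: "'k::field_char_0 \<Rightarrow> 'g::ab_group_add \<Rightarrow> 'g" and br +
  fixes lam :: 'k and d :: "'g \<Rightarrow> 'g"
  assumes d_linear: "Vector_Spaces.linear sg sg d"
    and d_br: "d (br x1 x2 x3) =
      br (d x1) x2 x3 + br x1 (d x2) x3 + br x1 x2 (d x3)
      + sg lam (br (d x1) (d x2) x3) + sg lam (br x1 (d x2) (d x3)) + sg lam (br (d x1) x2 (d x3))
      + sg (lam\<^sup>2) (br (d x1) (d x2) (d x3))"

locale three_lie_representation = three_lie_algebra sg br + V: vector_space sv
  for sg :: "'k::field_char_0 \<Rightarrow> 'g::ab_group_add \<Rightarrow> 'g" and br
    and sv :: "'k \<Rightarrow> 'v::ab_group_add \<Rightarrow> 'v" +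
  fixes rho :: "'g \<Rightarrow> 'g \<Rightarrow> 'v \<Rightarrow> 'v"
  assumes rho_linear: "Vector_Spaces.linear sv sv (rho x y)"
    and rho_linear1: "Vector_Spaces.linear sg sv (\<lambda>x. rho x y v)"
    and rho_linear2: "Vector_Spaces.linear sg sv (\<lambda>y. rho x y v)"
    and rho_skew: "rho y x v = - rho x y v"
    and rho_rep1: "rho x1 x2 (rho x3 x4 v) =
      rho (br x1 x2 x3) x4 v + rho x3 (br x1 x2 x4) v + rho x3 x4 (rho x1 x2 v)"
    and rho_rep2: "rho x1 (br x2 x3 x4) v =
      rho x3 x4 (rho x1 x2 v) - rho x2 x4 (rho x1 x3 v) + rho x2 x3 (rho x1 x4 v)"

locale diff_three_lie_representation =
  diff_three_lie_algebra sg br lam d + three_lie_representation sg br sv rho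
  for sg :: "'k::field_char_0 \<Rightarrow> 'g::ab_group_add \<Rightarrow> 'g" and br and lam and d
    and sv :: "'k \<Rightarrow> 'v::ab_group_add \<Rightarrow> 'v" and rho +
  fixes dV :: "'v \<Rightarrow> 'v"
  assumes dV_linear: "Vector_Spaces.linear sv sv dV"
    and dV_rho: "dV (rho x1 x2 v) =
      rho (d x1) x2 v + rho x1 (d x2) v + sv lam (rho (d x1) (d x2) v) + rho x1 x2 (dV v)
      + sv lam (rho (d x1) x2 (dV v) + rho x1 (d x2) (dV v) + sv lam (rho (d x1) (d x2) (dV v)))"

definition rho_hat ::
  "('k \<Rightarrow> 'v::ab_group_add \<Rightarrow> 'v) \<Rightarrow> 'k \<Rightarrow> ('g \<Rightarrow> 'g) \<Rightarrow> ('g \<Rightarrow> 'g \<Rightarrow> 'v \<Rightarrow> 'v) \<Rightarrow> 'g \<Rightarrow> 'g \<Rightarrow> 'v \<Rightarrow> 'v"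
  where "rho_hat sv lam d rho x y v =
    rho x y v + sv lam (rho (d x) y v + rho x (d y) v + sv lam (rho (d x) (d y) v))"

section \<open>The exterior square\<close>

text \<open>
  The exterior square of \<open>\<gg>\<close> is the quotient of the free vector space on \<open>\<gg> \<times> \<gg>\<close> by the
  subspace spanned by the bilinearity relations and the elements \<open>(x, x)\<close>. Since the quotient
  depends on the scaling \<open>sg\<close>, it is a set of cosets and not a type of its own.
\<close>

type_synonym ('k, 'g) free_pairs = "'g \<times> 'g \<Rightarrow>\<^sub>0 'k"

definition free_scale :: "'k::field \<Rightarrow> ('k, 'g) free_pairs \<Rightarrow> ('k, 'g) free_pairs"
  where "free_scale c P = Poly_Mapping.map ((*) c) P"

abbreviation gen :: "'g \<Rightarrow> 'g \<Rightarrow> ('k::field, 'g) free_pairs"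
  where "gen x y \<equiv> Poly_Mapping.single (x, y) 1"

definition ext_relators ::
  "('k::field \<Rightarrow> 'g::ab_group_add \<Rightarrow> 'g) \<Rightarrow> ('k, 'g) free_pairs set"
  where "ext_relators sg =
      {gen (x + x') y - gen x y - gen x' y | x x' y. True}
    \<union> {gen x (y + y') - gen x y - gen x y' | x y y'. True}
    \<union> {gen (sg c x) y - free_scale c (gen x y) | c x y. True}
    \<union> {gen x (sg c y) - free_scale c (gen x y) | c x y. True}
    \<union> {gen x x | x. True}"

definition ext_rel ::
  "('k::field \<Rightarrow> 'g::ab_group_add \<Rightarrow> 'g) \<Rightarrow> (('k, 'g) free_pairs \<times> ('k, 'g) free_pairs) set"
  where "ext_rel sg = {(P, Q). P - Q \<in> module.span free_scale (ext_relators sg)}"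

definition ext_sq ::
  "('k::field \<Rightarrow> 'g::ab_group_add \<Rightarrow> 'g) \<Rightarrow> ('k, 'g) free_pairs set set"
  where "ext_sq sg = UNIV // ext_rel sg"

definition wedge ::
  "('k::field \<Rightarrow> 'g::ab_group_add \<Rightarrow> 'g) \<Rightarrow> 'g \<Rightarrow> 'g \<Rightarrow> ('k, 'g) free_pairs set"
  where "wedge sg x y = ext_rel sg `` {gen x y}"

definition ext_add ::
  "('k::field \<Rightarrow> 'g::ab_group_add \<Rightarrow> 'g) \<Rightarrow>
    ('k, 'g) free_pairs set \<Rightarrow> ('k, 'g) free_pairs set \<Rightarrow> ('k, 'g) free_pairs set"
  where "ext_add sg X Y = (\<Union>P\<in>X. \<Union>Q\<in>Y. ext_rel sg `` {P + Q})"

definition ext_scale ::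
  "('k::field \<Rightarrow> 'g::ab_group_add \<Rightarrow> 'g) \<Rightarrow>
    'k \<Rightarrow> ('k, 'g) free_pairs set \<Rightarrow> ('k, 'g) free_pairs set"
  where "ext_scale sg c X = (\<Union>P\<in>X. ext_rel sg `` {free_scale c P})"

text \<open>
  The linear map on the exterior square induced by an alternating bilinear map \<open>b\<close>: it sends
  \<open>x \<and> y\<close> to \<open>b x y\<close>. For such \<open>b\<close> the set below has exactly one element, as the value does
  not depend on the representative \<open>P\<close> of \<open>X\<close>.
\<close>
definition ext_lift ::
  "('k::field \<Rightarrow> 'v::ab_group_add \<Rightarrow> 'v) \<Rightarrow> ('g \<Rightarrow> 'g \<Rightarrow> 'v) \<Rightarrow> ('k, 'g) free_pairs set \<Rightarrow> 'v"
  where "ext_lift sv b X = the_elem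
    ((\<lambda>P. \<Sum>q\<in>Poly_Mapping.keys P. sv (Poly_Mapping.lookup P q) (b (fst q) (snd q))) ` X)"

text \<open>
  The multilinear map in \<open>X\<^sub>1, \<dots>, X\<^sub>n\<close> whose value at \<open>X\<^sub>i = x\<^sub>i \<and> y\<^sub>i\<close> is
  \<open>F [(x\<^sub>1, y\<^sub>1), \<dots>, (x\<^sub>n, y\<^sub>n)]\<close>, for \<open>F\<close> multilinear and alternating in each pair.
\<close>
fun multi_lift ::
  "('k::field \<Rightarrow> 'v::ab_group_add \<Rightarrow> 'v) \<Rightarrow> (('g \<times> 'g) list \<Rightarrow> 'v) \<Rightarrow>
    ('k, 'g) free_pairs set list \<Rightarrow> 'v"
  where
    "multi_lift sv F [] = F []"
  | "multi_lift sv F (X # Xs) =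
      ext_lift sv (\<lambda>x y. multi_lift sv (\<lambda>ps. F ((x, y) # ps)) Xs) X"

section \<open>Cochains\<close>

text \<open>
  A \<open>p\<close>-cochain takes the list \<open>[X\<^sub>1, \<dots>, X\<^bsub>p-1\<^esub>]\<close> and \<open>z\<close>. Cochains are extended by zero to
  lists of other lengths and to lists with entries outside the exterior square, so that equality
  of cochains is equality of functions.
\<close>
type_synonym ('k, 'g, 'v) cochain = "('k, 'g) free_pairs set list \<Rightarrow> 'g \<Rightarrow> 'v"

definition cochains ::
  "('k::field_char_0 \<Rightarrow> 'g::ab_group_add \<Rightarrow> 'g) \<Rightarrow> ('k \<Rightarrow> 'v::ab_group_add \<Rightarrow> 'v) \<Rightarrow>
    nat \<Rightarrow> ('k, 'g, 'v) cochain set"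
  where "cochains sg sv p = {f.
    (\<forall>Xs z. \<not> (length Xs = p - 1 \<and> set Xs \<subseteq> ext_sq sg) \<longrightarrow> f Xs z = 0) \<and>
    (\<forall>Xs. length Xs = p - 1 \<and> set Xs \<subseteq> ext_sq sg \<longrightarrow> Vector_Spaces.linear sg sv (f Xs)) \<and>
    (\<forall>As Bs z. length As + 1 + length Bs = p - 1 \<and> set As \<subseteq> ext_sq sg \<and> set Bs \<subseteq> ext_sq sg \<longrightarrow>
      (\<forall>X\<in>ext_sq sg. \<forall>Y\<in>ext_sq sg.
        f (As @ ext_add sg X Y # Bs) z = f (As @ X # Bs) z + f (As @ Y # Bs) z) \<and>
      (\<forall>c. \<forall>X\<in>ext_sq sg. f (As @ ext_scale sg c X # Bs) z = sv c (f (As @ X # Bs) z))) \<and>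
    (\<forall>As x y z. length As + 1 = p - 1 \<and> set As \<subseteq> ext_sq sg \<longrightarrow>
      f (As @ [wedge sg y x]) z = - f (As @ [wedge sg x y]) z \<and>
      f (As @ [wedge sg x z]) y = - f (As @ [wedge sg x y]) z)}"

definition extend ::
  "('k::field \<Rightarrow> 'g::ab_group_add \<Rightarrow> 'g) \<Rightarrow> ('k \<Rightarrow> 'v::ab_group_add \<Rightarrow> 'v) \<Rightarrow>
    nat \<Rightarrow> (('g \<times> 'g) list \<Rightarrow> 'g \<Rightarrow> 'v) \<Rightarrow> ('k, 'g, 'v) cochain"
  where "extend sg sv p F = (\<lambda>Xs z.
    if length Xs = p - 1 \<and> set Xs \<subseteq> ext_sq sg then multi_lift sv (\<lambda>ps. F ps z) Xs else 0)"

definition omit :: "nat \<Rightarrow> 'a list \<Rightarrow> 'a list"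
  where "omit i xs = take i xs @ drop (Suc i) xs"

text \<open>\<open>[X, Y]\<^sub>F\<close> for \<open>X = x\<^sub>1 \<and> x\<^sub>2\<close> and \<open>Y = y\<^sub>1 \<and> y\<^sub>2\<close>\<close>
definition bracket_F ::
  "('k::field \<Rightarrow> 'g::ab_group_add \<Rightarrow> 'g) \<Rightarrow> ('g \<Rightarrow> 'g \<Rightarrow> 'g \<Rightarrow> 'g) \<Rightarrow>
    'g \<times> 'g \<Rightarrow> 'g \<times> 'g \<Rightarrow> ('k, 'g) free_pairs set"
  where "bracket_F sg br = (\<lambda>(x1, x2) (y1, y2).
    ext_add sg (wedge sg y1 (br x1 x2 y2)) (wedge sg (br x1 x2 y1) y2))"

text \<open>
  \<open>cobd sg br sv r p\<close> is the coboundary from \<open>p\<close>-cochains to \<open>(p+1)\<close>-cochains with coefficient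
  action \<open>r\<close>. It is given by its values at \<open>X\<^sub>i = x\<^sub>i \<and> y\<^sub>i\<close>; the entries are numbered from \<open>0\<close>,
  whence the shift in the exponents of \<open>-1\<close> depending on \<open>i\<close>. In the first sum the \<open>j\<close>-th entry
  is replaced before the \<open>i\<close>-th one is omitted.
\<close>
definition cobd ::
  "('k::field_char_0 \<Rightarrow> 'g::ab_group_add \<Rightarrow> 'g) \<Rightarrow> ('g \<Rightarrow> 'g \<Rightarrow> 'g \<Rightarrow> 'g) \<Rightarrow>
    ('k \<Rightarrow> 'v::ab_group_add \<Rightarrow> 'v) \<Rightarrow> ('g \<Rightarrow> 'g \<Rightarrow> 'v \<Rightarrow> 'v) \<Rightarrow>
    nat \<Rightarrow> ('k, 'g, 'v) cochain \<Rightarrow> ('k, 'g, 'v) cochain"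
  where "cobd sg br sv r p f = extend sg sv (p + 1) (\<lambda>ps z.
    let Xs = map (\<lambda>(x, y). wedge sg x y) ps; x = (\<lambda>i. fst (ps ! i)); y = (\<lambda>i. snd (ps ! i)) in
      (\<Sum>j<p. \<Sum>i<j. sv ((-1) ^ (i + 1)) (f (omit i (Xs[j := bracket_F sg br (ps ! i) (ps ! j)])) z))
    + (\<Sum>i<p. sv ((-1) ^ (i + 1)) (f (omit i Xs) (br (x i) (y i) z)))
    + (\<Sum>i<p. sv ((-1) ^ (i + 2)) (r (x i) (y i) (f (omit i Xs) z)))
    + sv ((-1) ^ (p + 1))
        (r (y (p - 1)) z (f (butlast Xs) (x (p - 1))) + r z (x (p - 1)) (f (butlast Xs) (y (p - 1)))))"

text \<open>
  The arguments \<open>x\<^sub>1, y\<^sub>1, \<dots>, x\<^bsub>p-1\<^esub>, y\<^bsub>p-1\<^esub>, z\<close> of a \<open>p\<close>-cochain are numbered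
  \<open>0, \<dots>, 2p - 2\<close>; \<open>S\<close> is the set of the chosen ones.
\<close>
definition insert_d ::
  "('k::field_char_0 \<Rightarrow> 'g::ab_group_add \<Rightarrow> 'g) \<Rightarrow> ('k \<Rightarrow> 'v::ab_group_add \<Rightarrow> 'v) \<Rightarrow>
    ('g \<Rightarrow> 'g) \<Rightarrow> nat \<Rightarrow> nat \<Rightarrow> ('k, 'g, 'v) cochain \<Rightarrow> ('k, 'g, 'v) cochain"
  where "insert_d sg sv d p k f = extend sg sv p (\<lambda>ps z.
    \<Sum>S | S \<subseteq> {..<2 * p - 1} \<and> card S = k.
      let D = (\<lambda>i u. if i \<in> S then d u else u) in
        f (map (\<lambda>i. wedge sg (D (2 * i) (fst (ps ! i))) (D (2 * i + 1) (snd (ps ! i)))) [0..<p - 1])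
          (D (2 * p - 2) z))"

definition delta ::
  "('k::field_char_0 \<Rightarrow> 'g::ab_group_add \<Rightarrow> 'g) \<Rightarrow> 'k \<Rightarrow> ('g \<Rightarrow> 'g) \<Rightarrow>
    ('k \<Rightarrow> 'v::ab_group_add \<Rightarrow> 'v) \<Rightarrow> ('v \<Rightarrow> 'v) \<Rightarrow>
    nat \<Rightarrow> ('k, 'g, 'v) cochain \<Rightarrow> ('k, 'g, 'v) cochain"
  where "delta sg lam d sv dV p f = (\<lambda>Xs z.
    (\<Sum>k = 1..2 * p - 1. sv (lam ^ (k - 1)) (insert_d sg sv d p k f Xs z)) - dV (f Xs z))"

section \<open>The complex of a differential 3-Lie algebra with coefficients in a representation\<close>

text \<open>In degree 1 the space of cochains is \<^term>\<open>cochains sg sv 1\<close>; the definition below is for \<open>p \<ge> 2\<close>.\<close>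
definition diff_cochains ::
  "('k::field_char_0 \<Rightarrow> 'g::ab_group_add \<Rightarrow> 'g) \<Rightarrow> ('k \<Rightarrow> 'v::ab_group_add \<Rightarrow> 'v) \<Rightarrow>
    nat \<Rightarrow> (('k, 'g, 'v) cochain \<times> ('k, 'g, 'v) cochain) set"
  where "diff_cochains sg sv p = cochains sg sv p \<times> cochains sg sv (p - 1)"

definition diff_cobd1 ::
  "('k::field_char_0 \<Rightarrow> 'g::ab_group_add \<Rightarrow> 'g) \<Rightarrow> ('g \<Rightarrow> 'g \<Rightarrow> 'g \<Rightarrow> 'g) \<Rightarrow> 'k \<Rightarrow> ('g \<Rightarrow> 'g) \<Rightarrow>
    ('k \<Rightarrow> 'v::ab_group_add \<Rightarrow> 'v) \<Rightarrow> ('g \<Rightarrow> 'g \<Rightarrow> 'v \<Rightarrow> 'v) \<Rightarrow> ('v \<Rightarrow> 'v) \<Rightarrow>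
    ('k, 'g, 'v) cochain \<Rightarrow> ('k, 'g, 'v) cochain \<times> ('k, 'g, 'v) cochain"
  where "diff_cobd1 sg br lam d sv rho dV f =
    (cobd sg br sv rho 1 f, \<lambda>Xs z. - delta sg lam d sv dV 1 f Xs z)"

definition diff_cobd ::
  "('k::field_char_0 \<Rightarrow> 'g::ab_group_add \<Rightarrow> 'g) \<Rightarrow> ('g \<Rightarrow> 'g \<Rightarrow> 'g \<Rightarrow> 'g) \<Rightarrow> 'k \<Rightarrow> ('g \<Rightarrow> 'g) \<Rightarrow>
    ('k \<Rightarrow> 'v::ab_group_add \<Rightarrow> 'v) \<Rightarrow> ('g \<Rightarrow> 'g \<Rightarrow> 'v \<Rightarrow> 'v) \<Rightarrow> ('v \<Rightarrow> 'v) \<Rightarrow> nat \<Rightarrow>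
    ('k, 'g, 'v) cochain \<times> ('k, 'g, 'v) cochain \<Rightarrow> ('k, 'g, 'v) cochain \<times> ('k, 'g, 'v) cochain"
  where "diff_cobd sg br lam d sv rho dV p = (\<lambda>(f, g).
    (cobd sg br sv rho p f,
     \<lambda>Xs z. cobd sg br sv (rho_hat sv lam d rho) (p - 1) g Xs z
       + sv ((-1) ^ p) (delta sg lam d sv dV p f Xs z)))"

end

theory Submission
  imports Defs
begin

text \<open>
  A cochain is determined by its values on decomposable arguments, that is, by an alternating
  multilinear map \<open>F\<close> on lists of pairs. Write \<open>\<iota>\<^sub>X F\<close> for \<open>F\<close> with first argument \<open>X\<close>, and \<open>L\<^sub>X\<close> for
  the Lie derivative. Cartan's formula \<open>\<iota>\<^sub>X \<partial> = L\<^sub>X - \<partial> \<iota>\<^sub>X\<close> determines \<open>\<partial>\<close> by recursion on the number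
  of arguments, and induction gives \<open>L\<^sub>X \<partial> = \<partial> L\<^sub>X\<close> from \<open>[L\<^sub>X, L\<^sub>Y] = L\<^bsub>[X,Y]\<^esub>\<close>, and then \<open>\<partial> \<partial> = 0\<close>.

  The map \<open>D = 1 + \<lambda> d\<close> is a homomorphism of 3-Lie algebras and the modified action is \<open>\<rho>\<close> composed
  with \<open>D\<close>; so it is again a representation, and \<open>T F = F \<circ> D\<close> satisfies \<open>\<partial>\<^sub>\<lambda> T = T \<partial>\<close>. Put
  \<open>\<Delta>(x \<and> y) = dx \<and> y + x \<and> dy + \<lambda> dx \<and> dy\<close>. Then \<open>\<iota>\<^sub>X \<delta> = \<delta> \<iota>\<^sub>X + T \<iota>\<^bsub>\<Delta>X\<^esub>\<close>, and the Lie derivative for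
  the modified action satisfies \<open>L\<^sub>X \<delta> = \<delta> L\<^sub>X + T L\<^bsub>\<Delta>X\<^esub>\<close>. With Cartan's formula these identities
  yield \<open>\<partial>\<^sub>\<lambda> \<delta> = \<delta> \<partial>\<close> by induction, also for \<open>\<lambda> = 0\<close>.
\<close>

section \<open>The exterior square\<close>

lemma lookup_free_scale [simp]: "Poly_Mapping.lookup (free_scale c P) q = c * Poly_Mapping.lookup P q"
  unfolding free_scale_def by (auto simp: Poly_Mapping.map.rep_eq when_def)

interpretation free: vector_space free_scale
  by standard (auto intro!: poly_mapping_eqI simp: lookup_add algebra_simps)

locale exterior_forms = G: vector_space sg + V: vector_space sv
  for sg :: "'k::field_char_0 \<Rightarrow> 'g::ab_group_add \<Rightarrow> 'g"
    and sv :: "'k \<Rightarrow> 'v::ab_group_add \<Rightarrow> 'v"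
begin

lemma linear_iff: "Vector_Spaces.linear sg sv f \<longleftrightarrow>
    (\<forall>x y. f (x + y) = f x + f y) \<and> (\<forall>c x. f (sg c x) = sv c (f x))"
  unfolding Vector_Spaces.linear_iff
  using G.vector_space_axioms V.vector_space_axioms by blast

section \<open>Cosets modulo the relations and their linear operations\<close>

abbreviation cls :: "('k, 'g) free_pairs \<Rightarrow> ('k, 'g) free_pairs set"
  where "cls P \<equiv> ext_rel sg `` {P}"

lemma equiv_ext_rel: "equiv UNIV (ext_rel sg)"
proof (rule equivI)
  show "refl (ext_rel sg)"
    unfolding refl_on_def ext_rel_def by (auto simp: free.span_zero)
  show "sym (ext_rel sg)"
    unfolding sym_def ext_rel_def by (auto dest: free.span_neg)
  show "trans (ext_rel sg)"
    unfolding trans_def ext_rel_def by (auto dest: free.span_add)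
qed auto

lemma cls_eq_iff: "cls P = cls Q \<longleftrightarrow> P - Q \<in> free.span (ext_relators sg)"
  using eq_equiv_class_iff[OF equiv_ext_rel, of P Q] by (auto simp: ext_rel_def)

lemma mem_cls: "Q \<in> cls P \<longleftrightarrow> P - Q \<in> free.span (ext_relators sg)"
  by (auto simp: ext_rel_def)

lemma cls_self: "P \<in> cls P"
  unfolding mem_cls by (simp add: free.span_zero)

lemma ext_sq_iff: "X \<in> ext_sq sg \<longleftrightarrow> (\<exists>P. X = cls P)"
  by (auto simp: ext_sq_def quotient_def)

lemma cls_in_ext_sq [simp]: "cls P \<in> ext_sq sg"
  by (auto simp: ext_sq_iff)

lemma wedge_in_ext_sq [simp]: "wedge sg x y \<in> ext_sq sg"
  by (simp add: wedge_def)

text \<open>The union in \<open>ext_add\<close> runs over all representatives of both cosets.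
  Changing a representative changes the sum by an element of the span, so all members of the union
  coincide.\<close>

lemma ext_add_cls: "ext_add sg (cls P) (cls Q) = cls (P + Q)"
proof -
  have "cls (P' + Q') = cls (P + Q)" if "P' \<in> cls P" "Q' \<in> cls Q" for P' Q'
    using free.span_neg[OF free.span_add[OF that[unfolded mem_cls]]]
    by (auto simp: cls_eq_iff algebra_simps)
  then show ?thesis
    unfolding ext_add_def using cls_self[of P] cls_self[of Q] by blast
qed

lemma ext_scale_cls: "ext_scale sg c (cls P) = cls (free_scale c P)"
proof -
  have "cls (free_scale c P') = cls (free_scale c P)" if "P' \<in> cls P" for P'
    using free.span_neg[OF free.span_scale[OF that[unfolded mem_cls], of c]]
    by (auto simp: cls_eq_iff free.scale_right_diff_distrib)
  then show ?thesis
    unfolding ext_scale_def using cls_self[of P] by blast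
qed

lemma ext_add_in_ext_sq [simp]:
  "X \<in> ext_sq sg \<Longrightarrow> Y \<in> ext_sq sg \<Longrightarrow> ext_add sg X Y \<in> ext_sq sg"
  by (auto simp: ext_sq_iff ext_add_cls)

lemma ext_scale_in_ext_sq [simp]: "X \<in> ext_sq sg \<Longrightarrow> ext_scale sg c X \<in> ext_sq sg"
  by (auto simp: ext_sq_iff ext_scale_cls)

lemma wedge_add_left: "wedge sg (x + x') y = ext_add sg (wedge sg x y) (wedge sg x' y)"
  unfolding wedge_def ext_add_cls cls_eq_iff ext_relators_def diff_diff_eq[symmetric]
  by (rule free.span_base) blast

lemma wedge_scale_left: "wedge sg (sg c x) y = ext_scale sg c (wedge sg x y)"
  unfolding wedge_def ext_scale_cls cls_eq_iff ext_relators_def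
  by (rule free.span_base) blast

text \<open>Polarisation: expand \<open>gen (x + y) (x + y)\<close> bilinearly modulo the relations;
  squares are relations themselves, so the two mixed terms must cancel.\<close>

lemma wedge_skew: "wedge sg y x = ext_scale sg (- 1) (wedge sg x y)"
proof -
  let ?S = "free.span (ext_relators sg)"
  have sq: "gen u u \<in> ?S" for u
    unfolding ext_relators_def by (rule free.span_base) blast
  have 1: "gen (x + y) (x + y) - gen x (x + y) - gen y (x + y) \<in> ?S"
    unfolding ext_relators_def by (rule free.span_base) blast
  have 2: "gen u (x + y) - gen u x - gen u y \<in> ?S" for u
    unfolding ext_relators_def by (rule free.span_base) blast
  have "gen (x + y) (x + y) - (gen (x + y) (x + y) - gen x (x + y) - gen y (x + y))
      - (gen x (x + y) - gen x x - gen x y) - (gen y (x + y) - gen y x - gen y y)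
      - gen x x - gen y y \<in> ?S"
    by (intro free.span_diff sq 1 2)
  then have "gen y x + gen x y \<in> ?S"
    by (simp add: algebra_simps)
  then show ?thesis
    by (simp add: wedge_def ext_scale_cls cls_eq_iff)
qed

text \<open>The generators span the free vector space, so the wedges span the quotient. This is what
  allows cochains to be compared on decomposable arguments only.\<close>

lemma ext_sq_induct [consumes 1, case_names wedge add scale]:
  assumes X: "X \<in> ext_sq sg"
    and wedge: "\<And>x y. P (wedge sg x y)"
    and add: "\<And>X Y. X \<in> ext_sq sg \<Longrightarrow> Y \<in> ext_sq sg \<Longrightarrow> P X \<Longrightarrow> P Y \<Longrightarrow> P (ext_add sg X Y)"
    and scale: "\<And>c X. X \<in> ext_sq sg \<Longrightarrow> P X \<Longrightarrow> P (ext_scale sg c X)"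
  shows "P X"
proof -
  obtain p where p: "X = cls p"
    using X by (auto simp: ext_sq_iff)
  have single: "P (cls (Poly_Mapping.single q c))" for q c
  proof -
    have "Poly_Mapping.single q c = free_scale c (gen (fst q) (snd q))"
      by (auto intro!: poly_mapping_eqI simp: lookup_single when_def)
    then show ?thesis
      using scale[OF wedge_in_ext_sq wedge, of c "fst q" "snd q"]
      by (simp only: wedge_def ext_scale_cls)
  qed
  have "P (cls p)"
  proof (induction p rule: Poly_Mapping.update_induct)
    case const
    then show ?case using single[of undefined 0] by simp
  next
    case (update p q c)
    \<comment> \<open>The induction adds a key \<open>q\<close> outside the support of
      \<open>p\<close>, so updating amounts to adding a single term.\<close>
    then have "Poly_Mapping.update q c p = p + Poly_Mapping.single q c"
      by (auto intro!: poly_mapping_eqI simp: lookup_add lookup_single lookup_update when_def in_keys_iff)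
    then show ?case
      using add[of "cls p" "cls (Poly_Mapping.single q c)"] update single by (simp add: ext_add_cls)
  qed
  then show ?thesis by (simp add: p)
qed

section \<open>Alternating bilinear maps and the linear maps they induce\<close>

definition altbil :: "('g \<Rightarrow> 'g \<Rightarrow> 'v) \<Rightarrow> bool"
  where "altbil b \<longleftrightarrow> (\<forall>x x' y. b (x + x') y = b x y + b x' y)
    \<and> (\<forall>c x y. b (sg c x) y = sv c (b x y)) \<and> (\<forall>x y. b y x = - b x y)"

text \<open>The hypothesis gives 2 v = 0, and 2 is invertible in characteristic 0.\<close>

lemma eq_neg_imp_zero:
  assumes "v = - (v::'v)" shows "v = 0"
proof -
  have "sv 2 v = sv 1 v + sv 1 v"
    by (subst V.scale_left_distrib[symmetric]) simp
  also have "\<dots> = 0"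
    using assms by (simp add: eq_neg_iff_add_eq_0)
  finally show ?thesis by simp
qed

text \<open>\<open>altbil\<close> stores linearity in the first argument and skew-symmetry.
  Exchanging the arguments gives linearity in the second one, and characteristic 0 gives vanishing
  on the diagonal.\<close>

lemma altbilD:
  assumes "altbil b"
  shows "b (x + x') y = b x y + b x' y" "b x (y + y') = b x y + b x y'"
    "b (sg c x) y = sv c (b x y)" "b x (sg c y) = sv c (b x y)"
    "b y x = - b x y" "b x x = 0"
proof -
  have add: "b (x + x') y = b x y + b x' y" and scale: "b (sg c x) y = sv c (b x y)"
    and skew: "b y x = - b x y" for x x' y c
    using assms unfolding altbil_def by blast+
  show "b (x + x') y = b x y + b x' y" "b (sg c x) y = sv c (b x y)" "b y x = - b x y"
    by (fact add scale skew)+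
  show "b x x = 0" using skew[of x x] by (rule eq_neg_imp_zero)
  show "b x (y + y') = b x y + b x y'"
    by (metis add skew minus_add_distrib)
  show "b x (sg c y) = sv c (b x y)"
    by (metis scale skew V.scale_minus_right)
qed

lemma altbilI:
  assumes "\<And>x x' y. b (x + x') y = b x y + b x' y" "\<And>c x y. b (sg c x) y = sv c (b x y)"
    "\<And>x y. b y x = - b x y"
  shows "altbil b"
  using assms unfolding altbil_def by blast

definition eval_free :: "('g \<Rightarrow> 'g \<Rightarrow> 'v) \<Rightarrow> ('k, 'g) free_pairs \<Rightarrow> 'v"
  where "eval_free b P =
    (\<Sum>q\<in>Poly_Mapping.keys P. sv (Poly_Mapping.lookup P q) (b (fst q) (snd q)))"

text \<open>Brings sums over different supports to a common index set: by cancellation,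
  \<open>P + Q\<close> may have fewer keys than \<open>P\<close> and \<open>Q\<close>
  together.\<close>

lemma eval_free_superset:
  assumes "finite A" "Poly_Mapping.keys P \<subseteq> A"
  shows "eval_free b P = (\<Sum>q\<in>A. sv (Poly_Mapping.lookup P q) (b (fst q) (snd q)))"
  unfolding eval_free_def using assms
  by (intro sum.mono_neutral_left) (auto simp: in_keys_iff)

lemma eval_free_add: "eval_free b (P + Q) = eval_free b P + eval_free b Q"
proof -
  let ?A = "Poly_Mapping.keys P \<union> Poly_Mapping.keys Q"
  have "eval_free b R = (\<Sum>q\<in>?A. sv (Poly_Mapping.lookup R q) (b (fst q) (snd q)))"
    if "R \<in> {P, Q, P + Q}" for R
    using that Poly_Mapping.keys_add[of P Q] by (intro eval_free_superset) auto
  then show ?thesis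
    by (simp add: lookup_add V.scale_left_distrib sum.distrib)
qed

lemma eval_free_scale: "eval_free b (free_scale c P) = sv c (eval_free b P)"
proof -
  have "Poly_Mapping.keys (free_scale c P) \<subseteq> Poly_Mapping.keys P"
    by (auto simp: in_keys_iff)
  then have "eval_free b (free_scale c P) =
      (\<Sum>q\<in>Poly_Mapping.keys P. sv (c * Poly_Mapping.lookup P q) (b (fst q) (snd q)))"
    by (subst eval_free_superset[of "Poly_Mapping.keys P"]) auto
  then show ?thesis
    by (simp add: eval_free_def V.scale_sum_right)
qed

lemma eval_free_diff: "eval_free b (P - Q) = eval_free b P - eval_free b Q"
  using eval_free_add[of b "P - Q" Q] by (simp add: algebra_simps)

lemma eval_free_gen: "eval_free b (gen x y) = b x y"
  by (simp add: eval_free_def)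

text \<open>It suffices to check the five families of relations; they express additivity and
  homogeneity in both arguments and vanishing on the diagonal.\<close>

lemma eval_free_relators:
  assumes "altbil b" "P \<in> free.span (ext_relators sg)"
  shows "eval_free b P = 0"
  using assms(2)
proof (induction rule: free.span_induct_alt)
  case base
  then show ?case by (simp add: eval_free_def)
next
  case (step c r q)
  have "eval_free b r = 0"
    using step(1) unfolding ext_relators_def
    by (elim UnE CollectE exE conjE; hypsubst)
      (simp_all only: eval_free_diff eval_free_scale eval_free_gen altbilD(1-4,6)[OF assms(1)],
       simp_all)
  then show ?case using step by (simp add: eval_free_add eval_free_scale)
qed

text \<open>The linear extension of \<open>b\<close> kills the relations, hence is constant on a
  coset, and \<open>the_elem\<close> in \<open>ext_lift\<close> is applied to a singleton. This is
  the existence half of the universal property.\<close>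

lemma ext_lift_cls:
  assumes "altbil b"
  shows "ext_lift sv b (cls P) = eval_free b P"
proof -
  have "eval_free b Q = eval_free b P" if "Q \<in> cls P" for Q
    using eval_free_relators[OF assms that[unfolded mem_cls]] by (simp add: eval_free_diff)
  then have "eval_free b ` cls P = (\<lambda>_. eval_free b P) ` cls P"
    by (rule image_cong[OF refl])
  also have "\<dots> = {eval_free b P}"
    using cls_self by (rule image_constant)
  finally have "eval_free b ` cls P = {eval_free b P}" .
  then show ?thesis
    by (simp add: ext_lift_def eval_free_def[abs_def])
qed

lemma ext_lift_wedge: "altbil b \<Longrightarrow> ext_lift sv b (wedge sg x y) = b x y"
  by (simp add: wedge_def ext_lift_cls eval_free_gen)

lemma ext_lift_add:
  assumes "altbil b" "X \<in> ext_sq sg" "Y \<in> ext_sq sg"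
  shows "ext_lift sv b (ext_add sg X Y) = ext_lift sv b X + ext_lift sv b Y"
  using assms by (auto simp: ext_sq_iff ext_add_cls ext_lift_cls eval_free_add)

lemma ext_lift_scale:
  assumes "altbil b" "X \<in> ext_sq sg"
  shows "ext_lift sv b (ext_scale sg c X) = sv c (ext_lift sv b X)"
  using assms by (auto simp: ext_sq_iff ext_scale_cls ext_lift_cls eval_free_scale)

lemma altbil_add:
  assumes "altbil b" "altbil b'"
  shows "altbil (\<lambda>x y. b x y + b' x y)"
proof (rule altbilI)
  show "b y x + b' y x = - (b x y + b' x y)" for x y
    using altbilD(5)[OF assms(1), of y x] altbilD(5)[OF assms(2), of y x] by simp
qed (simp_all add: altbilD(1,3)[OF assms(1)] altbilD(1,3)[OF assms(2)] V.scale_right_distrib)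

lemma altbil_scale:
  assumes "altbil b"
  shows "altbil (\<lambda>x y. sv c (b x y))"
proof (rule altbilI)
  show "sv c (b y x) = - sv c (b x y)" for x y
    by (subst altbilD(5)[OF assms]) simp
qed (simp_all add: altbilD(1,3)[OF assms] V.scale_right_distrib mult.commute)

lemma ext_lift_add_fun:
  assumes "altbil b" "altbil b'" "X \<in> ext_sq sg"
  shows "ext_lift sv (\<lambda>x y. b x y + b' x y) X = ext_lift sv b X + ext_lift sv b' X"
  using assms altbil_add[OF assms(1,2)]
  by (auto simp: ext_sq_iff ext_lift_cls eval_free_def V.scale_right_distrib sum.distrib)

lemma ext_lift_scale_fun:
  assumes "altbil b" "X \<in> ext_sq sg"
  shows "ext_lift sv (\<lambda>x y. sv c (b x y)) X = sv c (ext_lift sv b X)"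
  using assms altbil_scale[OF assms(1)]
  by (auto simp: ext_sq_iff ext_lift_cls eval_free_def V.scale_sum_right mult.commute)

section \<open>Multilinear maps on lists of pairs\<close>

text \<open>Lists of all lengths are treated at once, so that fixing leading or trailing pairs gives
  a map of the same kind.\<close>

definition multi_alt :: "(('g \<times> 'g) list \<Rightarrow> 'v) \<Rightarrow> bool"
  where "multi_alt F \<longleftrightarrow> (\<forall>As Bs. altbil (\<lambda>x y. F (As @ (x, y) # Bs)))"

lemma multi_altI: "(\<And>As Bs. altbil (\<lambda>x y. F (As @ (x, y) # Bs))) \<Longrightarrow> multi_alt F"
  by (simp add: multi_alt_def)

lemma multi_alt_altbil: "multi_alt F \<Longrightarrow> altbil (\<lambda>x y. F ((x, y) # Bs))"
  unfolding multi_alt_def by (drule spec[of _ "[]"]) simp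

lemma multi_alt_Cons: "multi_alt F \<Longrightarrow> multi_alt (\<lambda>ps. F (X # ps))"
  unfolding multi_alt_def
proof safe
  fix As Bs
  assume "\<forall>As Bs. altbil (\<lambda>x y. F (As @ (x, y) # Bs))"
  from spec[OF spec[OF this, of "X # As"], of Bs]
  show "altbil (\<lambda>x y. F (X # As @ (x, y) # Bs))" by simp
qed

lemma multi_alt_snoc: "multi_alt F \<Longrightarrow> multi_alt (\<lambda>ps. F (ps @ qs))"
  unfolding multi_alt_def by simp

text \<open>The three statements need a joint induction: linearity in \<open>F\<close> for a longer
  list uses alternation in the first pair for the shorter one, and alternation in turn follows from
  linearity in \<open>F\<close>.\<close>

lemma multi_lift_linear:
  assumes "set Xs \<subseteq> ext_sq sg" "multi_alt F"
  shows "multi_alt F' \<Longrightarrow>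
      multi_lift sv (\<lambda>ps. F ps + F' ps) Xs = multi_lift sv F Xs + multi_lift sv F' Xs"
    and "multi_lift sv (\<lambda>ps. sv c (F ps)) Xs = sv c (multi_lift sv F Xs)"
    and "altbil (\<lambda>x y. multi_lift sv (\<lambda>ps. F ((x, y) # ps)) Xs)"
proof -
  have "(\<forall>F F'. multi_alt F \<longrightarrow> multi_alt F' \<longrightarrow>
      multi_lift sv (\<lambda>ps. F ps + F' ps) Xs = multi_lift sv F Xs + multi_lift sv F' Xs)
    \<and> (\<forall>c F. multi_alt F \<longrightarrow> multi_lift sv (\<lambda>ps. sv c (F ps)) Xs = sv c (multi_lift sv F Xs))
    \<and> (\<forall>F. multi_alt F \<longrightarrow> altbil (\<lambda>x y. multi_lift sv (\<lambda>ps. F ((x, y) # ps)) Xs))"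
    using assms(1)
  proof (induction Xs)
    case Nil
    show ?case
      by (intro conjI allI impI; simp only: multi_lift.simps; rule multi_alt_altbil; assumption)
  next
    case (Cons X Xs)
    then have X: "X \<in> ext_sq sg" and sub: "set Xs \<subseteq> ext_sq sg" by simp_all
    note IH = Cons.IH[OF sub]
    note IH_add = IH[THEN conjunct1, rule_format]
      and IH_scale = IH[THEN conjunct2, THEN conjunct1, rule_format]
      and alt = IH[THEN conjunct2, THEN conjunct2, rule_format]
    have add: "multi_lift sv (\<lambda>ps. F ps + F' ps) (X # Xs) =
        multi_lift sv F (X # Xs) + multi_lift sv F' (X # Xs)" if "multi_alt F" "multi_alt F'" for F F'
      using ext_lift_add_fun[OF alt[OF that(1)] alt[OF that(2)] X]
      by (simp only: multi_lift.simps IH_add[OF multi_alt_Cons[OF that(1)] multi_alt_Cons[OF that(2)]])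
    have scale: "multi_lift sv (\<lambda>ps. sv c (F ps)) (X # Xs) = sv c (multi_lift sv F (X # Xs))"
      if "multi_alt F" for c F
      using ext_lift_scale_fun[OF alt[OF that] X]
      by (simp only: multi_lift.simps IH_scale[OF multi_alt_Cons[OF that]])
    have "altbil (\<lambda>x y. multi_lift sv (\<lambda>ps. F ((x, y) # ps)) (X # Xs))" if F: "multi_alt F" for F
    proof (rule altbilI)
      fix x x' y :: 'g and c
      note b = altbilD[OF multi_alt_altbil[OF F]]
      show "multi_lift sv (\<lambda>ps. F ((x + x', y) # ps)) (X # Xs) =
          multi_lift sv (\<lambda>ps. F ((x, y) # ps)) (X # Xs) + multi_lift sv (\<lambda>ps. F ((x', y) # ps)) (X # Xs)"
        using add[OF multi_alt_Cons[OF F] multi_alt_Cons[OF F]] by (simp only: b(1))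
      show "multi_lift sv (\<lambda>ps. F ((sg c x, y) # ps)) (X # Xs) =
          sv c (multi_lift sv (\<lambda>ps. F ((x, y) # ps)) (X # Xs))"
        using scale[OF multi_alt_Cons[OF F]] by (simp only: b(3))
      have "(\<lambda>ps. F ((y, x) # ps)) = (\<lambda>ps. sv (-1) (F ((x, y) # ps)))"
        using F by (intro ext) (simp add: altbilD(5)[OF multi_alt_altbil[OF F], of y x])
      then show "multi_lift sv (\<lambda>ps. F ((y, x) # ps)) (X # Xs) =
          - multi_lift sv (\<lambda>ps. F ((x, y) # ps)) (X # Xs)"
        using scale[OF multi_alt_Cons[OF F], of "-1"] by (simp del: multi_lift.simps)
    qed
    with add scale show ?case by blast
  qed
  with assms(2)
  show "multi_alt F' \<Longrightarrow>
      multi_lift sv (\<lambda>ps. F ps + F' ps) Xs = multi_lift sv F Xs + multi_lift sv F' Xs"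
    and "multi_lift sv (\<lambda>ps. sv c (F ps)) Xs = sv c (multi_lift sv F Xs)"
    and "altbil (\<lambda>x y. multi_lift sv (\<lambda>ps. F ((x, y) # ps)) Xs)"
    by blast+
qed

text \<open>The lifts of the entries before the slot are linear in the map being lifted, so a sum or
  a scalar in the slot passes through them to the front.\<close>

lemma multi_lift_slot:
  assumes "set As \<subseteq> ext_sq sg" "set Bs \<subseteq> ext_sq sg" "X \<in> ext_sq sg" "Y \<in> ext_sq sg" "multi_alt F"
  shows "multi_lift sv F (As @ ext_add sg X Y # Bs) =
      multi_lift sv F (As @ X # Bs) + multi_lift sv F (As @ Y # Bs)"
    and "multi_lift sv F (As @ ext_scale sg c X # Bs) = sv c (multi_lift sv F (As @ X # Bs))"
proof -
  have "(\<forall>F. multi_alt F \<longrightarrow> multi_lift sv F (As @ ext_add sg X Y # Bs) =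
        multi_lift sv F (As @ X # Bs) + multi_lift sv F (As @ Y # Bs))
    \<and> (\<forall>F. multi_alt F \<longrightarrow> multi_lift sv F (As @ ext_scale sg c X # Bs) = sv c (multi_lift sv F (As @ X # Bs)))"
    using assms(1)
  proof (induction As)
    case Nil
    then show ?case
      using assms ext_lift_add ext_lift_scale multi_lift_linear(3)[OF assms(2)] by simp
  next
    case (Cons A As)
    have alt: "altbil (\<lambda>x y. multi_lift sv (\<lambda>ps. F ((x, y) # ps)) (As @ Z # Bs))"
      if "multi_alt F" "Z \<in> ext_sq sg" for F Z
      using that Cons.prems assms(2) by (intro multi_lift_linear(3)) auto
    have A: "A \<in> ext_sq sg" using Cons.prems by simp
    have sub: "set As \<subseteq> ext_sq sg" using Cons.prems by simp
    note IH = Cons.IH[OF sub, THEN conjunct1, rule_format, OF multi_alt_Cons]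
      Cons.IH[OF sub, THEN conjunct2, rule_format, OF multi_alt_Cons]
    show ?case
      by (auto simp: IH ext_lift_add_fun[OF alt alt] ext_lift_scale_fun[OF alt] assms A)
  qed
  with assms(5) show "multi_lift sv F (As @ ext_add sg X Y # Bs) =
      multi_lift sv F (As @ X # Bs) + multi_lift sv F (As @ Y # Bs)"
    and "multi_lift sv F (As @ ext_scale sg c X # Bs) = sv c (multi_lift sv F (As @ X # Bs))"
    by blast+
qed

lemma multi_lift_cong:
  "(\<And>ps. length ps = length Xs \<Longrightarrow> F ps = F' ps) \<Longrightarrow> multi_lift sv F Xs = multi_lift sv F' Xs"
proof (induction Xs arbitrary: F F')
  case (Cons X Xs)
  have "multi_lift sv (\<lambda>ps. F ((x, y) # ps)) Xs = multi_lift sv (\<lambda>ps. F' ((x, y) # ps)) Xs" for x y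
    by (rule Cons.IH, rule Cons.prems) simp
  then show ?case by simp
qed simp

abbreviation wedges :: "('g \<times> 'g) list \<Rightarrow> ('k, 'g) free_pairs set list"
  where "wedges \<equiv> map (\<lambda>(x, y). wedge sg x y)"

lemma wedges_in_ext_sq [simp]: "set (wedges ps) \<subseteq> ext_sq sg"
  by auto

text \<open>With \<open>Xs\<close> empty this is evaluation at decomposables. A general prefix is
  allowed for the sake of skew-symmetry in the last pair and \<open>z\<close>, where the earlier
  entries are arbitrary.\<close>

lemma multi_lift_append_wedges:
  assumes "set Xs \<subseteq> ext_sq sg" "multi_alt F"
  shows "multi_lift sv F (Xs @ wedges ps) = multi_lift sv (\<lambda>qs. F (qs @ ps)) Xs"
  using assms
proof (induction Xs arbitrary: F)
  case Nil
  then show ?case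
  proof (induction ps arbitrary: F)
    case (Cons p ps)
    then show ?case
      using multi_lift_linear(3)[of "wedges ps", OF wedges_in_ext_sq Cons.prems(2)]
      by (cases p) (simp add: ext_lift_wedge multi_alt_Cons)
  qed simp
next
  case (Cons X Xs)
  then show ?case by (simp add: multi_alt_Cons)
qed

lemma multi_lift_wedges: "multi_alt F \<Longrightarrow> multi_lift sv F (wedges ps) = F ps"
  using multi_lift_append_wedges[of "[]"] by simp

lemma wedges_image [simp]: "(\<lambda>(x, y). wedge sg x y) ` S \<subseteq> ext_sq sg"
  by auto

section \<open>Cochains as multilinear maps on lists of pairs\<close>

text \<open>The last condition exchanges the second entry of the last pair with \<open>z\<close>;
  with alternation inside the pair it generates total skew-symmetry in the last three entries. No
  length is prescribed, so that contraction stays within the class.\<close>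

definition form :: "(('g \<times> 'g) list \<Rightarrow> 'g \<Rightarrow> 'v) \<Rightarrow> bool"
  where "form F \<longleftrightarrow> (\<forall>z. multi_alt (\<lambda>ps. F ps z))
    \<and> (\<forall>ps x y. F ps (x + y) = F ps x + F ps y) \<and> (\<forall>ps c x. F ps (sg c x) = sv c (F ps x))
    \<and> (\<forall>As x y z. F (As @ [(x, z)]) y = - F (As @ [(x, y)]) z)"

lemma formD:
  assumes "form F"
  shows "multi_alt (\<lambda>ps. F ps z)" "F ps (x + y) = F ps x + F ps y" "F ps (sg c x) = sv c (F ps x)"
    "F (As @ [(x, z)]) y = - F (As @ [(x, y)]) z"
  using assms unfolding form_def by blast+

definition on_pairs :: "('k, 'g, 'v) cochain \<Rightarrow> ('g \<times> 'g) list \<Rightarrow> 'g \<Rightarrow> 'v"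
  where "on_pairs f ps z = f (wedges ps) z"

lemma cochainsI:
  assumes "\<And>Xs z. \<not> (length Xs = p - 1 \<and> set Xs \<subseteq> ext_sq sg) \<Longrightarrow> f Xs z = 0"
    and "\<And>Xs. set Xs \<subseteq> ext_sq sg \<Longrightarrow> Vector_Spaces.linear sg sv (f Xs)"
    and "\<And>As Bs X Y z. set As \<subseteq> ext_sq sg \<Longrightarrow> set Bs \<subseteq> ext_sq sg \<Longrightarrow> X \<in> ext_sq sg \<Longrightarrow> Y \<in> ext_sq sg \<Longrightarrow>
      f (As @ ext_add sg X Y # Bs) z = f (As @ X # Bs) z + f (As @ Y # Bs) z"
    and "\<And>As Bs X c z. set As \<subseteq> ext_sq sg \<Longrightarrow> set Bs \<subseteq> ext_sq sg \<Longrightarrow> X \<in> ext_sq sg \<Longrightarrow>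
      f (As @ ext_scale sg c X # Bs) z = sv c (f (As @ X # Bs) z)"
    and "\<And>As x y z. set As \<subseteq> ext_sq sg \<Longrightarrow> f (As @ [wedge sg x z]) y = - f (As @ [wedge sg x y]) z"
  shows "f \<in> cochains sg sv p"
proof -
  \<comment> \<open>Skew-symmetry in the last pair is homogeneity in the last slot with factor
    -1.\<close>
  have "f (As @ [wedge sg y x]) z = - f (As @ [wedge sg x y]) z" if "set As \<subseteq> ext_sq sg" for As x y z
    using assms(4)[OF that, of "[]" "wedge sg x y" "- 1" z] by (simp add: wedge_skew[of y x])
  note skew = this
  show ?thesis
    unfolding cochains_def
    by (intro CollectI conjI allI impI ballI; (elim conjE)?; rule assms skew; (assumption | blast))
qed

lemma cochains_zero:
  "f \<in> cochains sg sv p \<Longrightarrow> \<not> (length Xs = p - 1 \<and> set Xs \<subseteq> ext_sq sg) \<Longrightarrow> f Xs z = 0"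
  by (auto simp: cochains_def)

text \<open>On lists of any other length all three values vanish, so the identity holds without a
  condition on the length.\<close>

lemma cochains_add:
  assumes "f \<in> cochains sg sv p" "set As \<subseteq> ext_sq sg" "set Bs \<subseteq> ext_sq sg" "X \<in> ext_sq sg" "Y \<in> ext_sq sg"
  shows "f (As @ ext_add sg X Y # Bs) z = f (As @ X # Bs) z + f (As @ Y # Bs) z"
proof (cases "length As + 1 + length Bs = p - 1")
  case True
  with assms show ?thesis unfolding cochains_def by blast
next
  case False
  then have "f (As @ Z # Bs) z = 0" for Z
    by (intro cochains_zero[OF assms(1)]) auto
  then show ?thesis by simp
qed

lemma cochains_scale:
  assumes "f \<in> cochains sg sv p" "set As \<subseteq> ext_sq sg" "set Bs \<subseteq> ext_sq sg" "X \<in> ext_sq sg"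
  shows "f (As @ ext_scale sg c X # Bs) z = sv c (f (As @ X # Bs) z)"
proof (cases "length As + 1 + length Bs = p - 1")
  case True
  with assms show ?thesis unfolding cochains_def by blast
next
  case False
  then have "f (As @ Z # Bs) z = 0" for Z
    by (intro cochains_zero[OF assms(1)]) auto
  then show ?thesis by simp
qed

lemma cochains_linear:
  assumes "f \<in> cochains sg sv p"
  shows "Vector_Spaces.linear sg sv (f Xs)"
proof (cases "length Xs = p - 1 \<and> set Xs \<subseteq> ext_sq sg")
  case True
  with assms show ?thesis unfolding cochains_def by blast
next
  case False
  then have "f Xs z = 0" for z
    by (rule cochains_zero[OF assms])
  then show ?thesis by (simp add: linear_iff)
qed

lemma cochains_skew:
  assumes "f \<in> cochains sg sv p" "set As \<subseteq> ext_sq sg"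
  shows "f (As @ [wedge sg x z]) y = - f (As @ [wedge sg x y]) z"
proof (cases "length As + 1 = p - 1")
  case True
  with assms show ?thesis unfolding cochains_def by blast
next
  case False
  then have "f (As @ [Z]) u = 0" for Z u
    by (intro cochains_zero[OF assms(1)]) auto
  then show ?thesis by simp
qed

lemma form_on_pairs:
  assumes "f \<in> cochains sg sv p"
  shows "form (on_pairs f)"
proof -
  have "multi_alt (\<lambda>ps. on_pairs f ps z)" for z
  proof (intro multi_altI altbilI)
    fix As Bs :: "('g \<times> 'g) list" and x x' y c
    show "on_pairs f (As @ (x + x', y) # Bs) z = on_pairs f (As @ (x, y) # Bs) z + on_pairs f (As @ (x', y) # Bs) z"
      by (simp add: on_pairs_def wedge_add_left cochains_add[OF assms wedges_in_ext_sq wedges_in_ext_sq])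
    show "on_pairs f (As @ (sg c x, y) # Bs) z = sv c (on_pairs f (As @ (x, y) # Bs) z)"
      by (simp add: on_pairs_def wedge_scale_left cochains_scale[OF assms wedges_in_ext_sq wedges_in_ext_sq])
    show "on_pairs f (As @ (y, x) # Bs) z = - on_pairs f (As @ (x, y) # Bs) z"
      by (simp add: on_pairs_def wedge_skew[of y x] cochains_scale[OF assms wedges_in_ext_sq wedges_in_ext_sq])
  qed
  moreover have "on_pairs f (As @ [(x, z)]) y = - on_pairs f (As @ [(x, y)]) z" for As x y z
    using cochains_skew[OF assms wedges_in_ext_sq, of As x z y] by (simp add: on_pairs_def)
  ultimately show ?thesis
    using cochains_linear[OF assms] unfolding form_def on_pairs_def linear_iff by blast
qed

lemma extend_wedges:
  assumes "form F" "length ps = p - 1"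
  shows "extend sg sv p F (wedges ps) z = F ps z"
  using assms by (simp add: extend_def formD(1) multi_lift_wedges)

lemma extend_cong:
  assumes "\<And>ps z. length ps = p - 1 \<Longrightarrow> F ps z = F' ps z"
  shows "extend sg sv p F = extend sg sv p F'"
  unfolding extend_def using assms by (auto intro!: ext multi_lift_cong)

lemma extend_in_cochains:
  assumes "form F"
  shows "extend sg sv p F \<in> cochains sg sv p"
proof -
  have F: "multi_alt (\<lambda>ps. F ps z)" for z
    using assms by (rule formD)
  have lin: "Vector_Spaces.linear sg sv (\<lambda>z. multi_lift sv (\<lambda>ps. F ps z) Xs)"
    if "set Xs \<subseteq> ext_sq sg" for Xs
    using multi_lift_linear(1)[OF that F F] multi_lift_linear(2)[OF that F] by (simp add: linear_iff formD(2,3)[OF assms])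
  have sk: "multi_lift sv (\<lambda>ps. F ps y) (As @ [wedge sg x z]) =
      - multi_lift sv (\<lambda>ps. F ps z) (As @ [wedge sg x y])" if "set As \<subseteq> ext_sq sg" for As x y z
  proof -
    have "multi_lift sv (\<lambda>ps. F ps y) (As @ [wedge sg x z]) =
        multi_lift sv (\<lambda>qs. sv (- 1) (F (qs @ [(x, y)]) z)) As"
      using multi_lift_append_wedges[OF that F, where ps = "[(x, z)]"]
      by (simp add: formD(4)[OF assms, of _ x z y])
    also have "\<dots> = - multi_lift sv (\<lambda>qs. F (qs @ [(x, y)]) z) As"
      using multi_lift_linear(2)[OF that multi_alt_snoc[OF F], where c = "- 1"] by simp
    finally show ?thesis
      using multi_lift_append_wedges[OF that F, where ps = "[(x, y)]"] by simp
  qed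
  show ?thesis
  proof (rule cochainsI)
    fix Xs :: "('k, 'g) free_pairs set list" assume Xs: "set Xs \<subseteq> ext_sq sg"
    show "Vector_Spaces.linear sg sv (extend sg sv p F Xs)"
      using lin[OF Xs] by (cases "length Xs = p - 1") (simp_all add: extend_def linear_iff)
  next
    fix As :: "('k, 'g) free_pairs set list" and x y z assume As: "set As \<subseteq> ext_sq sg"
    show "extend sg sv p F (As @ [wedge sg x z]) y = - extend sg sv p F (As @ [wedge sg x y]) z"
      using sk[OF As, of y x z] by (auto simp: extend_def)
  qed (auto simp: extend_def multi_lift_slot[OF _ _ _ _ F] multi_lift_slot(2)[OF _ _ _ _ F])
qed

lemma cochains_eqI:
  assumes "f \<in> cochains sg sv p" "f' \<in> cochains sg sv p"
    and eq: "\<And>ps z. length ps = p - 1 \<Longrightarrow> on_pairs f ps z = on_pairs f' ps z"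
  shows "f = f'"
proof (intro ext)
  \<comment> \<open>Generalised to arbitrary entries followed by wedges:
    \<open>ext_sq_induct\<close> reduces the last arbitrary entry to a wedge, which then joins the
    suffix.\<close>
  have "f (Xs @ wedges ps) z = f' (Xs @ wedges ps) z"
    if "set Xs \<subseteq> ext_sq sg" "length Xs + length ps = p - 1" for Xs ps z
    using that
  proof (induction Xs arbitrary: ps rule: rev_induct)
    case Nil
    then show ?case using eq by (simp add: on_pairs_def)
  next
    case (snoc X Xs)
    have "X \<in> ext_sq sg" using snoc.prems by simp
    then show ?case
    proof (induction X rule: ext_sq_induct)
      case (wedge x y)
      then show ?case using snoc.IH[of "(x, y) # ps"] snoc.prems by simp
    next
      case (add X Y)
      then show ?case
        using snoc.prems cochains_add[OF assms(1) _ wedges_in_ext_sq]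
          cochains_add[OF assms(2) _ wedges_in_ext_sq] by simp
    next
      case (scale c X)
      then show ?case
        using snoc.prems cochains_scale[OF assms(1) _ wedges_in_ext_sq]
          cochains_scale[OF assms(2) _ wedges_in_ext_sq] by simp
    qed
  qed
  from this[of _ "[]"] show "f Xs z = f' Xs z" for Xs z
    using cochains_zero[OF assms(1), of Xs z] cochains_zero[OF assms(2), of Xs z]
    by (cases "length Xs = p - 1 \<and> set Xs \<subseteq> ext_sq sg") auto
qed

lemma cochains_plus:
  assumes f: "f \<in> cochains sg sv p" and f': "f' \<in> cochains sg sv p"
  shows "(\<lambda>Xs z. f Xs z + f' Xs z) \<in> cochains sg sv p"
proof (rule cochainsI)
  show "f Xs z + f' Xs z = 0" if "\<not> (length Xs = p - 1 \<and> set Xs \<subseteq> ext_sq sg)" for Xs z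
    using cochains_zero[OF f that] cochains_zero[OF f' that] by simp
  show "Vector_Spaces.linear sg sv (\<lambda>z. f Xs z + f' Xs z)" for Xs
    using cochains_linear[OF f, of Xs] cochains_linear[OF f', of Xs]
    by (simp add: linear_iff V.scale_right_distrib)
  show "f (As @ [wedge sg x z]) y + f' (As @ [wedge sg x z]) y =
      - (f (As @ [wedge sg x y]) z + f' (As @ [wedge sg x y]) z)" if "set As \<subseteq> ext_sq sg" for As x y z
    using cochains_skew[OF f that, of x z y] cochains_skew[OF f' that, of x z y] by simp
qed (simp_all add: cochains_add[OF f] cochains_add[OF f'] cochains_scale[OF f] cochains_scale[OF f']
    V.scale_right_distrib)

lemma cochains_compose:
  assumes f: "f \<in> cochains sg sv p"
    and add: "\<And>u v. h (u + v) = h u + h v" and scale: "\<And>c u. h (sv c u) = sv c (h u)"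
  shows "(\<lambda>Xs z. h (f Xs z)) \<in> cochains sg sv p"
proof (rule cochainsI)
  have "h 0 = 0" using scale[of 0 0] by simp
  then show "h (f Xs z) = 0" if "\<not> (length Xs = p - 1 \<and> set Xs \<subseteq> ext_sq sg)" for Xs z
    using cochains_zero[OF f that] by simp
  show "Vector_Spaces.linear sg sv (\<lambda>z. h (f Xs z))" for Xs
    using cochains_linear[OF f, of Xs] by (simp add: linear_iff add scale)
  show "h (f (As @ [wedge sg x z]) y) = - h (f (As @ [wedge sg x y]) z)" if "set As \<subseteq> ext_sq sg" for As x y z
    using scale[of "- 1"] by (simp add: cochains_skew[OF f that, of x z y])
qed (simp_all add: cochains_add[OF f] cochains_scale[OF f] add scale)

lemma cochains_0: "(\<lambda>_ _. 0) \<in> cochains sg sv p"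
  by (rule cochainsI) (simp_all add: linear_iff)

section \<open>Operations on forms\<close>

lemma altbil_diff:
  assumes "altbil b" "altbil b'"
  shows "altbil (\<lambda>x y. b x y - b' x y)"
  using altbil_add[OF assms(1) altbil_scale[OF assms(2), of "- 1"]] by simp

lemma form_head: "form F \<Longrightarrow> altbil (\<lambda>x y. F ((x, y) # ps) z)"
  using multi_alt_altbil[OF formD(1)] .

lemma form_skew: "form F \<Longrightarrow> F ((y, x) # ps) z = - F ((x, y) # ps) z"
  using altbilD(5)[OF form_head] .

lemma form_slot: "form F \<Longrightarrow> altbil (\<lambda>x y. F (As @ (x, y) # Bs) z)"
  using formD(1) unfolding multi_alt_def by blast

lemma formI:
  assumes "\<And>As Bs z. altbil (\<lambda>x y. F (As @ (x, y) # Bs) z)"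
    and "\<And>ps x y. F ps (x + y) = F ps x + F ps y" "\<And>ps c x. F ps (sg c x) = sv c (F ps x)"
    and "\<And>As x y z. F (As @ [(x, z)]) y = - F (As @ [(x, y)]) z"
  shows "form F"
  using assms unfolding form_def multi_alt_def by blast

text \<open>Contraction with the pair \<open>q\<close>, along which all inductions on the number of
  arguments proceed.\<close>

lemma form_Cons:
  assumes "form F"
  shows "form (\<lambda>ps. F (q # ps))"
proof (rule formI)
  show "altbil (\<lambda>x y. F (q # As @ (x, y) # Bs) z)" for As Bs z
    using form_slot[OF assms, of "q # As"] by simp
  show "F (q # As @ [(x, z)]) y = - F (q # As @ [(x, y)]) z" for As x y z
    using formD(4)[OF assms, of "q # As" x z y] by simp
qed (simp_all add: formD(2,3)[OF assms])

lemmas form_lin =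
  altbilD(1)[OF form_head] altbilD(2)[OF form_head] altbilD(3)[OF form_head] altbilD(4)[OF form_head]
  formD(2,3)

end

section \<open>Lie derivative and coboundary\<close>

sublocale three_lie_representation \<subseteq> exterior_forms sg sv ..

context three_lie_representation
begin

lemma br_lin:
  "br (x + x') y z = br x y z + br x' y z" "br x (y + y') z = br x y z + br x y' z"
  "br x y (z + z') = br x y z + br x y z'"
  "br (sg c x) y z = sg c (br x y z)" "br x (sg c y) z = sg c (br x y z)"
  "br x y (sg c z) = sg c (br x y z)"
  using br_linear1 br_linear2 br_linear3 unfolding Vector_Spaces.linear_iff by blast+

lemma rho_lin:
  "rho (x + x') y v = rho x y v + rho x' y v" "rho x (y + y') v = rho x y v + rho x y' v"
  "rho x y (v + v') = rho x y v + rho x y v'"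
  "rho (sg c x) y v = sv c (rho x y v)" "rho x (sg c y) v = sv c (rho x y v)"
  "rho x y (sv c v) = sv c (rho x y v)"
  using rho_linear rho_linear1 rho_linear2 unfolding Vector_Spaces.linear_iff by blast+

lemma rho_zero [simp]: "rho x y 0 = 0"
  using rho_lin(6)[of x y 0 0] by simp

lemma rho_minus [simp]: "rho x y (- v) = - rho x y v"
  using rho_lin(6)[of x y "- 1" v] by simp

lemma rho_diff: "rho x y (v - v') = rho x y v - rho x y v'"
  using rho_lin(3)[of x y v "- v'"] by simp

text \<open>The Lie derivative along the wedge of \<open>a\<close> and \<open>b\<close>. Each pair
  contributes the two terms with the bracket in one of its entries; the action on the value and the
  bracket with \<open>z\<close> come from the empty list.\<close>

fun lie :: "'g \<Rightarrow> 'g \<Rightarrow> (('g \<times> 'g) list \<Rightarrow> 'g \<Rightarrow> 'v) \<Rightarrow> ('g \<times> 'g) list \<Rightarrow> 'g \<Rightarrow> 'v"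
  where
    "lie a b F [] z = rho a b (F [] z) - F [] (br a b z)"
  | "lie a b F ((x, y) # ps) z = lie a b (\<lambda>qs. F ((x, y) # qs)) ps z
      - F ((x, br a b y) # ps) z - F ((br a b x, y) # ps) z"

text \<open>Unapplied form of the recursion, for rewriting where the Lie derivative is the argument
  of another operator.\<close>

lemma lie_Cons_fun:
  "(\<lambda>ps. lie a b F ((x, y) # ps)) = (\<lambda>ps z. lie a b (\<lambda>qs. F ((x, y) # qs)) ps z
      - F ((x, br a b y) # ps) z - F ((br a b x, y) # ps) z)"
  by (simp add: fun_eq_iff)

text \<open>Cartan's formula, taken as the definition of the coboundary.\<close>
fun cob :: "(('g \<times> 'g) list \<Rightarrow> 'g \<Rightarrow> 'v) \<Rightarrow> ('g \<times> 'g) list \<Rightarrow> 'g \<Rightarrow> 'v"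
  where
    "cob F [] z = 0"
  | "cob F [(x, y)] z = lie x y F [] z + rho y z (F [] x) + rho z x (F [] y)"
  | "cob F ((x, y) # q # ps) z = lie x y F (q # ps) z - cob (\<lambda>qs. F ((x, y) # qs)) (q # ps) z"

lemma cob_Cons:
  "ps \<noteq> [] \<Longrightarrow> cob F ((x, y) # ps) z = lie x y F ps z - cob (\<lambda>qs. F ((x, y) # qs)) ps z"
  by (cases ps) simp_all

text \<open>The number of arguments is preserved, so only lists of that length matter. The
  restriction is essential later, as Cartan's formula \<open>cob_Cons\<close> is available on
  nonempty lists only.\<close>

lemma lie_cong:
  "(\<And>qs. length qs = length ps \<Longrightarrow> F qs = F' qs) \<Longrightarrow> lie a b F ps z = lie a b F' ps z"
proof (induction ps arbitrary: F F')
  case (Cons p ps)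
  have "lie a b (\<lambda>qs. F (p # qs)) ps z = lie a b (\<lambda>qs. F' (p # qs)) ps z"
    by (rule Cons.IH, rule Cons.prems) simp
  moreover have "F (q # ps) = F' (q # ps)" for q
    by (rule Cons.prems) simp
  ultimately show ?case by (cases p) simp
qed simp

lemma lie_add: "lie a b (\<lambda>ps z. F ps z + F' ps z) ps z = lie a b F ps z + lie a b F' ps z"
  by (induction ps arbitrary: F F') (auto simp: rho_lin)

lemma lie_scale: "lie a b (\<lambda>ps z. sv c (F ps z)) ps z = sv c (lie a b F ps z)"
  by (induction ps arbitrary: F) (auto simp: rho_lin V.scale_right_diff_distrib)

lemma lie_uminus: "lie a b (\<lambda>ps z. - F ps z) ps z = - lie a b F ps z"
  using lie_scale[of a b "- 1" F ps z] by simp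

lemma lie_diff: "lie a b (\<lambda>ps z. F ps z - F' ps z) ps z = lie a b F ps z - lie a b F' ps z"
  using lie_add[of a b F "\<lambda>ps z. - F' ps z" ps z] by (simp add: lie_uminus)

lemma lie_in_form:
  assumes "form F"
  shows "lie a b (\<lambda>ps. F ((x + x', y) # ps)) ps z =
      lie a b (\<lambda>ps. F ((x, y) # ps)) ps z + lie a b (\<lambda>ps. F ((x', y) # ps)) ps z"
    "lie a b (\<lambda>ps. F ((x, y + y') # ps)) ps z =
      lie a b (\<lambda>ps. F ((x, y) # ps)) ps z + lie a b (\<lambda>ps. F ((x, y') # ps)) ps z"
    "lie a b (\<lambda>ps. F ((sg c x, y) # ps)) ps z = sv c (lie a b (\<lambda>ps. F ((x, y) # ps)) ps z)"
    "lie a b (\<lambda>ps. F ((x, sg c y) # ps)) ps z = sv c (lie a b (\<lambda>ps. F ((x, y) # ps)) ps z)"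
  unfolding lie_add[symmetric] lie_scale[symmetric]
  by (rule lie_cong; rule ext; rule altbilD[OF form_head[OF assms]])+

lemma lie_linear:
  assumes "form F"
  shows "lie a b F ps (z + z') = lie a b F ps z + lie a b F ps z'"
    "lie a b F ps (sg c z) = sv c (lie a b F ps z)"
  using assms
proof (induction ps arbitrary: F)
  case Nil
  case 1 then show ?case by (simp add: formD br_lin rho_lin)
  case 2 then show ?case by (simp add: formD br_lin rho_lin V.scale_right_diff_distrib)
next
  case (Cons p ps)
  { case 1 with Cons.IH(1)[OF form_Cons[OF 1]] show ?case by (cases p) (simp add: formD(2))
  next
    case 2 with Cons.IH(2)[OF form_Cons[OF 2]] show ?case
      by (cases p) (simp add: formD(3) V.scale_right_diff_distrib) }
qed

lemma lie_slot:
  assumes "form F"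
  shows "altbil (\<lambda>x y. lie a b F (As @ (x, y) # Bs) z)"
  using assms
proof (induction As arbitrary: F)
  case Nil
  show ?case
  proof (rule altbilI)
    fix x y
    have "lie a b (\<lambda>ps. F ((y, x) # ps)) Bs z = - lie a b (\<lambda>ps. F ((x, y) # ps)) Bs z"
      unfolding lie_uminus[symmetric]
      by (rule lie_cong; rule ext; rule altbilD(5)[OF form_head[OF Nil]])
    then show "lie a b F ([] @ (y, x) # Bs) z = - lie a b F ([] @ (x, y) # Bs) z"
      by (simp add: form_skew[OF Nil, of "br a b y" x] form_skew[OF Nil, of y "br a b x"])
  qed (simp_all add: lie_in_form[OF Nil] form_lin[OF Nil] br_lin algebra_simps V.scale_right_diff_distrib)
next
  case (Cons p As)
  obtain u v where p: "p = (u, v)" by (cases p)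
  have "altbil (\<lambda>x y. F (q # As @ (x, y) # Bs) z)" for q
    using form_slot[OF form_Cons[OF Cons.prems]] .
  then show ?case
    unfolding p append_Cons lie.simps
    by (intro altbil_diff Cons.IH form_Cons Cons.prems) auto
qed

lemma lie_skew:
  assumes "form F"
  shows "lie a b F (As @ [(x, z)]) y = - lie a b F (As @ [(x, y)]) z"
  using assms
proof (induction As arbitrary: F)
  case Nil
  have sk: "F [(u, z)] y = - F [(u, y)] z" for u y z
    using formD(4)[OF Nil, of "[]" u z y] by simp
  show ?case
    using sk[of x z y] sk[of "br a b x" z y] sk[of x z "br a b y"] sk[of x "br a b z" y] by simp
next
  case (Cons p As)
  have "F (q # As @ [(x, z)]) y = - F (q # As @ [(x, y)]) z" for q
    using formD(4)[OF Cons.prems, of "q # As" x z y] by simp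
  from this[of "(fst p, br a b (snd p))"] this[of "(br a b (fst p), snd p)"]
  show ?case
    using Cons.IH[OF form_Cons[OF Cons.prems], of p] by (cases p) simp
qed

lemma form_lie: "form F \<Longrightarrow> form (lie a b F)"
  by (rule formI) (rule lie_slot lie_linear lie_skew; assumption)+

text \<open>The Lie derivative along X thus depends only on the element X of the exterior square.
  With \<open>cob_in_form\<close> this makes \<open>cob F\<close> alternating in its first
  pair.\<close>

lemma lie_altbil:
  assumes "form F"
  shows "altbil (\<lambda>a b. lie a b F ps z)"
  using assms
proof (induction ps arbitrary: F)
  case Nil
  show ?case
  proof (rule altbilI)
    show "lie b a F [] z = - lie a b F [] z" for a b
      using formD(3)[OF Nil, of "[]" "- 1" "br a b z"]
      by (simp add: rho_skew[of b a] br_skew12[of b a])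
  qed (simp_all add: rho_lin br_lin formD(2,3)[OF Nil] V.scale_right_diff_distrib)
next
  case (Cons p ps)
  obtain u v where p: "p = (u, v)" by (cases p)
  note F = form_lin(1-4)[OF Cons.prems]
  have neg: "F ((u, - w) # ps) z = - F ((u, w) # ps) z" "F ((- w, v) # ps) z = - F ((w, v) # ps) z" for w
    using F(4)[of u "- 1" w] F(3)[of "- 1" w] by simp_all
  have "altbil (\<lambda>a b. F ((u, br a b v) # ps) z)"
    by (rule altbilI) (simp_all only: F br_lin br_skew12[of _ _ v, symmetric] neg[symmetric])
  moreover have "altbil (\<lambda>a b. F ((br a b u, v) # ps) z)"
    by (rule altbilI) (simp_all only: F br_lin br_skew12[of _ _ u, symmetric] neg[symmetric])
  ultimately
  show ?case
    unfolding p lie.simps by (intro altbil_diff Cons.IH form_Cons Cons.prems)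
qed

text \<open>The commutator formula for Lie derivatives, the two wedges of \<open>bracket_F\<close>
  being written separately. In each argument it is the fundamental identity, and on the value it is
  \<open>rho_rep1\<close>.\<close>

lemma lie_lie:
  assumes "form F"
  shows "lie a b (lie c e F) ps z =
    lie c e (lie a b F) ps z + lie (br a b c) e F ps z + lie c (br a b e) F ps z"
  using assms
proof (induction ps arbitrary: F)
  case Nil
  then show ?case
    by (simp add: rho_rep1[of a b c e] br_fundamental[of a b c e z] rho_diff formD(2))
next
  case (Cons p ps)
  obtain x y where p: "p = (x, y)" by (cases p)
  show ?case
    using Cons.IH[OF form_Cons[OF Cons.prems], of p]
    by (simp add: p lie_Cons_fun lie_diff br_fundamental[of a b c e] form_lin[OF Cons.prems])
qed

section \<open>The coboundary: linearity, skew-symmetry, square zero\<close>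

lemma cob_cong:
  "(\<And>qs. Suc (length qs) = length ps \<Longrightarrow> F qs = F' qs) \<Longrightarrow> cob F ps z = cob F' ps z"
proof (induction ps arbitrary: F F')
  case (Cons p ps)
  show ?case
  proof (cases ps)
    case Nil
    then show ?thesis using Cons.prems[of "[]"] by (cases p) simp
  next
    case (Cons q qs)
    have "cob (\<lambda>qs. F (p # qs)) ps z = cob (\<lambda>qs. F' (p # qs)) ps z"
      by (rule Cons.IH, rule Cons.prems) simp
    moreover have "lie a b F ps z = lie a b F' ps z" for a b
      by (rule lie_cong, rule Cons.prems) simp
    ultimately show ?thesis using Cons by (cases p) simp
  qed
qed simp

lemma cob_add: "cob (\<lambda>ps z. F ps z + F' ps z) ps z = cob F ps z + cob F' ps z"
  by (induction F ps z arbitrary: F' rule: cob.induct) (simp_all add: lie_add rho_lin)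

lemma cob_scale: "cob (\<lambda>ps z. sv c (F ps z)) ps z = sv c (cob F ps z)"
  by (induction F ps z rule: cob.induct)
    (simp_all add: lie_scale rho_lin V.scale_right_diff_distrib V.scale_right_distrib)

lemma cob_uminus: "cob (\<lambda>ps z. - F ps z) ps z = - cob F ps z"
  using cob_scale[of "- 1" F ps z] by simp

lemma cob_diff: "cob (\<lambda>ps z. F ps z - F' ps z) ps z = cob F ps z - cob F' ps z"
  using cob_add[of F "\<lambda>ps z. - F' ps z" ps z] by (simp add: cob_uminus)

lemma cob_in_form:
  assumes "form F"
  shows "altbil (\<lambda>x y. cob (\<lambda>ps. F ((x, y) # ps)) ps z)"
proof (rule altbilI)
  fix x y x' c
  show "cob (\<lambda>ps. F ((x + x', y) # ps)) ps z =
      cob (\<lambda>ps. F ((x, y) # ps)) ps z + cob (\<lambda>ps. F ((x', y) # ps)) ps z"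
    unfolding cob_add[symmetric] by (rule cob_cong; rule ext; rule altbilD[OF form_head[OF assms]])
  show "cob (\<lambda>ps. F ((sg c x, y) # ps)) ps z = sv c (cob (\<lambda>ps. F ((x, y) # ps)) ps z)"
    unfolding cob_scale[symmetric] by (rule cob_cong; rule ext; rule altbilD[OF form_head[OF assms]])
  show "cob (\<lambda>ps. F ((y, x) # ps)) ps z = - cob (\<lambda>ps. F ((x, y) # ps)) ps z"
    unfolding cob_uminus[symmetric] by (rule cob_cong; rule ext; rule altbilD[OF form_head[OF assms]])
qed

text \<open>On one pair the coboundary is the cyclic sum of \<open>rho x y (F [] z)\<close> minus
  \<open>F [] (br x y z)\<close>: the two terms added to the Lie derivative complete the cyclic sum,
  which makes it totally skew.\<close>

lemma cob_single_skew:
  assumes "form F"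
  shows "cob F [(y, x)] z = - cob F [(x, y)] z" "cob F [(x, z)] y = - cob F [(x, y)] z"
proof -
  have neg: "F [] (- u) = - F [] u" for u
    using formD(3)[OF assms, of "[]" "- 1" u] by simp
  show "cob F [(y, x)] z = - cob F [(x, y)] z"
    by (simp add: neg rho_skew[of x z] rho_skew[of y x] rho_skew[of z y] br_skew12[of y x])
  show "cob F [(x, z)] y = - cob F [(x, y)] z"
    by (simp add: neg rho_skew[of z y] rho_skew[of y x] rho_skew[of z x] br_skew23[of x z y])
qed

lemma form_cob:
  assumes "form F"
  shows "form (cob F)"
proof (rule formI)
  show "altbil (\<lambda>x y. cob F (As @ (x, y) # Bs) z)" for As Bs z
    using assms
  proof (induction As arbitrary: F)
    case Nil
    show ?case
    proof (cases "Bs = []")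
      case True
      show ?thesis unfolding True append_Nil
      proof (rule altbilI)
        show "cob F [(y, x)] z = - cob F [(x, y)] z" for x y
          by (rule cob_single_skew[OF Nil])
      qed (simp_all add: rho_lin br_lin formD(2,3)[OF Nil] algebra_simps
          V.scale_right_diff_distrib V.scale_right_distrib)
    next
      case False
      then show ?thesis
        unfolding append_Nil cob_Cons[OF False]
        by (intro altbil_diff lie_altbil cob_in_form Nil)
    qed
  next
    case (Cons p As)
    obtain u v where p: "p = (u, v)" by (cases p)
    have ne: "As @ q # Bs \<noteq> []" for q by simp
    show ?case
      unfolding p append_Cons cob_Cons[OF ne]
      by (intro altbil_diff lie_slot Cons.IH form_Cons Cons.prems)
  qed
  have lin: "cob F ps (x + y) = cob F ps x + cob F ps y \<and> cob F ps (sg c x) = sv c (cob F ps x)" for ps x y c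
    using assms
  proof (induction ps arbitrary: F)
    case (Cons p ps)
    show ?case
    proof (cases "ps = []")
      case True
      then show ?thesis
        by (cases p) (simp add: rho_lin br_lin formD(2,3)[OF Cons.prems] algebra_simps
          V.scale_right_diff_distrib V.scale_right_distrib)
    next
      case False
      then show ?thesis
        using Cons.IH[OF form_Cons[OF Cons.prems], of p]
        by (cases p) (simp add: cob_Cons lie_linear[OF Cons.prems] V.scale_right_diff_distrib)
    qed
  qed simp
  then show "cob F ps (x + y) = cob F ps x + cob F ps y" "cob F ps (sg c x) = sv c (cob F ps x)" for ps x y c
    by blast+
  show "cob F (As @ [(x, z)]) y = - cob F (As @ [(x, y)]) z" for As x y z
    using assms
  proof (induction As arbitrary: F)
    case Nil
    then show ?case using cob_single_skew(2)[of F x z y] by simp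
  next
    case (Cons p As)
    then show ?case
      using Cons.IH[OF form_Cons[OF Cons.prems], of p] lie_skew[OF Cons.prems, of _ _ As x z y]
      by (cases p) (simp add: cob_Cons)
  qed
qed

text \<open>Expand both sides by Cartan's formula. The terms in which the bracket with
  \<open>a\<close> and \<open>b\<close> falls on the first pair cancel against the commutator from
  \<open>lie_lie\<close>; the contracted terms agree by induction.\<close>

lemma lie_cob:
  assumes "form F"
  shows "lie a b (cob F) ps z = cob (lie a b F) ps z"
  using assms
proof (induction ps arbitrary: F)
  case (Cons p ps)
  obtain x y where p: "p = (x, y)" by (cases p)
  show ?case
  proof (cases "ps = []")
    case True
    show ?thesis
      \<comment> \<open>\<open>lie_lie\<close> treats the Lie derivative contained in
        \<open>cob\<close>; the two additional terms of the single-pair case need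
        \<open>rho_rep1\<close> once more.\<close>
      using lie_lie[OF Cons.prems, of a b x y "[]" z]
      by (simp add: True p br_fundamental[of a b x y z] rho_diff rho_lin formD(2)[OF Cons.prems]
          rho_rep1[of a b])
  next
    case False
    have "lie a b (\<lambda>qs. cob F ((x, y) # qs)) ps z =
        lie a b (\<lambda>qs z. lie x y F qs z - cob (\<lambda>qs. F ((x, y) # qs)) qs z) ps z"
      using False by (intro lie_cong ext cob_Cons) auto
    then have 1: "lie a b (\<lambda>qs. cob F ((x, y) # qs)) ps z =
        lie a b (lie x y F) ps z - cob (lie a b (\<lambda>qs. F ((x, y) # qs))) ps z"
      by (simp add: lie_diff Cons.IH[OF form_Cons[OF Cons.prems]])
    show ?thesis
      using False
      by (simp add: p 1 cob_Cons lie_lie[OF Cons.prems, of a b x y] lie_Cons_fun cob_diff)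
  qed
qed simp

text \<open>Applying Cartan's formula twice to the contraction with X leaves L_X \<partial> F -
  \<partial> L_X F + \<partial> \<partial> of the contracted form, which vanishes by
  \<open>lie_cob\<close> and induction. Two pairs are a separate case, because there the inner
  coboundary acts on one pair and has its additional terms.\<close>

lemma cob_cob:
  assumes "form F"
  shows "cob (cob F) ps z = 0"
  using assms
proof (induction ps arbitrary: F)
  case (Cons p ps)
  obtain x y where p: "p = (x, y)" by (cases p)
  consider "ps = []" | u v where "ps = [(u, v)]" | q r qs where "ps = q # r # qs"
    by (metis list.exhaust surj_pair)
  then show ?case
  proof cases
    case 1
    then show ?thesis by (simp add: p)
  next
    case 2
    have "cob (cob F) (p # ps) z =
        cob (lie x y F) [(u, v)] z - cob (\<lambda>qs. cob F ((x, y) # qs)) [(u, v)] z"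
      by (simp only: p 2 cob.simps lie_cob[OF Cons.prems])
    \<comment> \<open>What survives is minus the coboundary of the additional terms, seen as a
      function of \<open>w\<close>. Two instances of \<open>rho_rep2\<close>, one for each of
      \<open>F [] x\<close> and \<open>F [] y\<close>, show that this function is a cocycle.\<close>
    also have "\<dots> = - (lie u v (\<lambda>_ w. rho y w (F [] x) + rho w x (F [] y)) [] z
        + rho v z (rho y u (F [] x) + rho u x (F [] y)) + rho z u (rho y v (F [] x) + rho v x (F [] y)))"
      by (simp add: rho_lin rho_diff)
    also have "\<dots> = 0"
      using rho_rep2[of y u v z "F [] x"] rho_rep2[of x u v z "F [] y"]
      by (simp add: rho_lin rho_diff rho_skew[of u x] rho_skew[of v x] rho_skew[of z x] rho_skew[of "br u v z" x]
          rho_skew[of z u])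
    finally show ?thesis .
  next
    case 3
    have "cob (\<lambda>qs. cob F ((x, y) # qs)) ps z =
        cob (\<lambda>qs z. lie x y F qs z - cob (\<lambda>qs. F ((x, y) # qs)) qs z) ps z"
      using 3 by (intro cob_cong ext cob_Cons) auto
    then show ?thesis
      using Cons.IH[OF form_Cons[OF Cons.prems]] 3
      by (simp add: p cob_diff lie_cob[OF Cons.prems])
  qed
qed simp

end

section \<open>Insertion of the derivation\<close>

context diff_three_lie_representation
begin

section \<open>The homomorphism \<open>D\<close> and the modified action\<close>

lemma d_lin: "d (x + y) = d x + d y" "d (sg c x) = sg c (d x)"
  using d_linear unfolding Vector_Spaces.linear_iff by blast+

lemma dV_lin: "dV (v + w) = dV v + dV w" "dV (sv c v) = sv c (dV v)"
  using dV_linear unfolding Vector_Spaces.linear_iff by blast+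

lemma dV_zero [simp]: "dV 0 = 0"
  using dV_lin(2)[of 0 0] by simp

lemma dV_minus [simp]: "dV (- v) = - dV v"
  using dV_lin(2)[of "- 1" v] by simp

lemma dV_diff: "dV (v - w) = dV v - dV w"
  using dV_lin(1)[of v "- w"] by simp

definition D :: "'g \<Rightarrow> 'g"
  where "D x = x + sg lam (d x)"

lemma D_lin: "D (x + y) = D x + D y" "D (sg c x) = sg c (D x)"
  by (simp_all add: D_def d_lin scale_right_distrib mult.commute)

text \<open>By trilinearity the right-hand side expands to \<open>br x y z\<close> plus
  \<open>lam\<close> times the right-hand side of \<open>d_br\<close>.\<close>

lemma D_br: "D (br x y z) = br (D x) (D y) (D z)"
  by (simp add: D_def d_br br_lin scale_right_distrib power2_eq_square add_ac)

lemma rho_hat_eq: "rho_hat sv lam d rho x y v = rho (D x) (D y) v"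
  by (simp add: rho_hat_def D_def rho_lin V.scale_right_distrib add_ac)

lemma dV_rho': "dV (rho x y v) =
    rho (d x) y v + rho x (d y) v + sv lam (rho (d x) (d y) v) + rho (D x) (D y) (dV v)"
  using dV_rho[of x y v] rho_hat_eq[of x y "dV v"] by (simp add: rho_hat_def)

end

text \<open>The modified action is the pullback of \<open>rho\<close> along the homomorphism
  \<open>D\<close>, hence a representation. All results on \<open>lie\<close> and \<open>cob\<close>
  become available for it under the prefix \<open>hat\<close>.\<close>

sublocale diff_three_lie_representation \<subseteq>
  hat: three_lie_representation sg br sv "rho_hat sv lam d rho"
proof unfold_locales
  fix x y x1 x2 x3 x4 v
  show "rho_hat sv lam d rho y x v = - rho_hat sv lam d rho x y v"
    unfolding rho_hat_eq by (rule rho_skew)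
  show "rho_hat sv lam d rho x1 x2 (rho_hat sv lam d rho x3 x4 v) =
      rho_hat sv lam d rho (br x1 x2 x3) x4 v + rho_hat sv lam d rho x3 (br x1 x2 x4) v +
      rho_hat sv lam d rho x3 x4 (rho_hat sv lam d rho x1 x2 v)"
    unfolding rho_hat_eq D_br by (rule rho_rep1)
  show "rho_hat sv lam d rho x1 (br x2 x3 x4) v =
      rho_hat sv lam d rho x3 x4 (rho_hat sv lam d rho x1 x2 v) -
      rho_hat sv lam d rho x2 x4 (rho_hat sv lam d rho x1 x3 v) +
      rho_hat sv lam d rho x2 x3 (rho_hat sv lam d rho x1 x4 v)"
    unfolding rho_hat_eq D_br by (rule rho_rep2)
qed (simp_all add: rho_hat_eq[abs_def] linear_iff Vector_Spaces.linear_iff[of sv sv] V.vector_space_axioms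
    rho_lin D_lin)

section \<open>Weighted sums over the sets of entries receiving \<open>d\<close>\<close>

context diff_three_lie_representation
begin

text \<open>\<open>dins c F\<close> is the sum over all sets \<open>S\<close> of entries of \<open>c |S|\<close> times \<open>F\<close> with \<open>d\<close> applied to
  the entries in \<open>S\<close>.\<close>
fun dins :: "(nat \<Rightarrow> 'k) \<Rightarrow> (('g \<times> 'g) list \<Rightarrow> 'g \<Rightarrow> 'v) \<Rightarrow> ('g \<times> 'g) list \<Rightarrow> 'g \<Rightarrow> 'v"
  where
    "dins c F [] z = sv (c 0) (F [] z) + sv (c 1) (F [] (d z))"
  | "dins c F ((x, y) # ps) z = dins c (\<lambda>qs. F ((x, y) # qs)) ps z
      + dins (\<lambda>n. c (Suc n)) (\<lambda>qs. F ((d x, y) # qs)) ps z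
      + dins (\<lambda>n. c (Suc n)) (\<lambda>qs. F ((x, d y) # qs)) ps z
      + dins (\<lambda>n. c (Suc (Suc n))) (\<lambda>qs. F ((d x, d y) # qs)) ps z"

lemma dins_cong:
  "(\<And>qs. length qs = length ps \<Longrightarrow> F qs = F' qs) \<Longrightarrow> dins c F ps z = dins c F' ps z"
proof (induction ps arbitrary: c F F')
  case (Cons p ps)
  have "dins c (\<lambda>qs. F (q # qs)) ps z = dins c (\<lambda>qs. F' (q # qs)) ps z" for c q
    by (rule Cons.IH, rule Cons.prems) simp
  then show ?case by (cases p) simp
qed simp

text \<open>There are \<open>2 * length ps + 1\<close> entries, counting \<open>z\<close>, so no set
  of chosen entries is larger.\<close>

lemma dins_cong_weight:
  "(\<And>n. n \<le> 2 * length ps + 1 \<Longrightarrow> c n = c' n) \<Longrightarrow> dins c F ps z = dins c' F ps z"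
proof (induction ps arbitrary: c c' F)
  case (Cons p ps)
  have "dins c F ps z = dins c' F ps z" "dins (\<lambda>n. c (Suc n)) F ps z = dins (\<lambda>n. c' (Suc n)) F ps z"
    "dins (\<lambda>n. c (Suc (Suc n))) F ps z = dins (\<lambda>n. c' (Suc (Suc n))) F ps z" for F
    by (rule Cons.IH; rule Cons.prems; simp)+
  then show ?case by (cases p) simp
qed simp

lemma dins_add: "dins c (\<lambda>ps z. F ps z + F' ps z) ps z = dins c F ps z + dins c F' ps z"
  by (induction ps arbitrary: c F F') (auto simp: V.scale_right_distrib add_ac)

lemma dins_scale: "dins c (\<lambda>ps z. sv a (F ps z)) ps z = sv a (dins c F ps z)"
  by (induction ps arbitrary: c F) (auto simp: V.scale_right_distrib mult.commute)

lemma dins_uminus: "dins c (\<lambda>ps z. - F ps z) ps z = - dins c F ps z"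
  using dins_scale[of c "- 1" F ps z] by simp

lemma dins_diff: "dins c (\<lambda>ps z. F ps z - F' ps z) ps z = dins c F ps z - dins c F' ps z"
  using dins_add[of c F "\<lambda>ps z. - F' ps z" ps z] by (simp add: dins_uminus)

lemma dins_scale_weight: "dins (\<lambda>n. a * c n) F ps z = sv a (dins c F ps z)"
  by (induction ps arbitrary: c F) (auto simp: V.scale_right_distrib)

lemma dins_add_weight: "dins (\<lambda>n. c n + c' n) F ps z = dins c F ps z + dins c' F ps z"
  by (induction ps arbitrary: c c' F) (auto simp: V.scale_left_distrib add_ac)

text \<open>Linearity in the weight merges the sum over k in \<open>delta\<close> into a single
  \<open>dins\<close>.\<close>

lemma dins_sum_weight:
  "finite K \<Longrightarrow> dins (\<lambda>n. \<Sum>k\<in>K. a k * c k n) F ps z = (\<Sum>k\<in>K. sv (a k) (dins (c k) F ps z))"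
proof (induction K rule: finite_induct)
  case empty
  show ?case using dins_scale_weight[of 0 "\<lambda>_. 0"] by simp
qed (simp add: dins_add_weight dins_scale_weight)

lemma dins_in_form:
  assumes "form F"
  shows "altbil (\<lambda>x y. dins c (\<lambda>ps. F ((x, y) # ps)) ps z)"
proof (rule altbilI)
  fix x y x' a
  show "dins c (\<lambda>ps. F ((x + x', y) # ps)) ps z =
      dins c (\<lambda>ps. F ((x, y) # ps)) ps z + dins c (\<lambda>ps. F ((x', y) # ps)) ps z"
    unfolding dins_add[symmetric] by (rule dins_cong; rule ext; rule altbilD[OF form_head[OF assms]])
  show "dins c (\<lambda>ps. F ((sg a x, y) # ps)) ps z = sv a (dins c (\<lambda>ps. F ((x, y) # ps)) ps z)"
    unfolding dins_scale[symmetric] by (rule dins_cong; rule ext; rule altbilD[OF form_head[OF assms]])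
  show "dins c (\<lambda>ps. F ((y, x) # ps)) ps z = - dins c (\<lambda>ps. F ((x, y) # ps)) ps z"
    unfolding dins_uminus[symmetric] by (rule dins_cong; rule ext; rule altbilD[OF form_head[OF assms]])
qed

lemma form_dins:
  assumes "form F"
  shows "form (dins c F)"
proof (rule formI)
  show "altbil (\<lambda>x y. dins c F (As @ (x, y) # Bs) z)" for As Bs z
    using assms
  proof (induction As arbitrary: c F)
    case Nil
    note b = dins_in_form[OF Nil]
    have sk: "dins c (\<lambda>ps. F ((y, x) # ps)) Bs z = - dins c (\<lambda>ps. F ((x, y) # ps)) Bs z" for c y x
      by (rule altbilD(5)[OF b])
    show ?case
    proof (rule altbilI)
      fix x y
      show "dins c F ([] @ (y, x) # Bs) z = - dins c F ([] @ (x, y) # Bs) z"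
        by (simp add: sk[of _ y x] sk[of _ "d y" x] sk[of _ y "d x"] sk[of _ "d y" "d x"])
    qed (simp_all add: altbilD(1,3)[OF b] d_lin V.scale_right_distrib)
  next
    case (Cons p As)
    obtain u v where p: "p = (u, v)" by (cases p)
    show ?case
      unfolding p append_Cons dins.simps
      by (intro altbil_add Cons.IH form_Cons Cons.prems)
  qed
  have lin: "dins c F ps (x + y) = dins c F ps x + dins c F ps y \<and> dins c F ps (sg a x) = sv a (dins c F ps x)"
    for ps x y a
    using assms
  proof (induction ps arbitrary: c F)
    case Nil
    then show ?case
      by (simp add: d_lin formD(2,3)[OF Nil] V.scale_right_distrib mult.commute)
  next
    case (Cons p ps)
    then show ?case
      using Cons.IH[OF form_Cons[OF Cons.prems]] by (cases p) (simp add: V.scale_right_distrib)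
  qed
  then show "dins c F ps (x + y) = dins c F ps x + dins c F ps y"
    "dins c F ps (sg a x) = sv a (dins c F ps x)" for ps x y a
    by blast+
  show "dins c F (As @ [(x, z)]) y = - dins c F (As @ [(x, y)]) z" for As x y z
    using assms
  proof (induction As arbitrary: c F)
    case Nil
    have sk: "F [(u, z)] y = - F [(u, y)] z" for u y z
      using formD(4)[OF Nil, of "[]" u z y] by simp
    show ?case
      using sk[of x z y] sk[of x "d z" y] sk[of x z "d y"] sk[of x "d z" "d y"]
        sk[of "d x" z y] sk[of "d x" "d z" y] sk[of "d x" z "d y"] sk[of "d x" "d z" "d y"]
      by simp
  next
    case (Cons p As)
    then show ?case
      by (cases p) (simp add: Cons.IH[OF form_Cons[OF Cons.prems]])
  qed
qed

section \<open>Commutation of \<delta> with Lie derivative and coboundary\<close>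

definition tr :: "(('g \<times> 'g) list \<Rightarrow> 'g \<Rightarrow> 'v) \<Rightarrow> ('g \<times> 'g) list \<Rightarrow> 'g \<Rightarrow> 'v"
  where "tr F ps z = F (map (map_prod D D) ps) (D z)"

text \<open>Multilinear expansion of \<open>F\<close> with \<open>D\<close> on every entry: a set of
  chosen entries contributes \<open>lam\<close> to the power of its size.\<close>

lemma dins_power:
  assumes "form F"
  shows "dins (\<lambda>n. lam ^ n) F ps z = tr F ps z"
  using assms
proof (induction ps arbitrary: F)
  case Nil
  then show ?case by (simp add: tr_def D_def formD(2,3))
next
  case (Cons p ps)
  obtain u v where p: "p = (u, v)" by (cases p)
  show ?case
    using Cons.IH[OF form_Cons[OF Cons.prems]]
    by (simp add: p dins_scale_weight tr_def form_lin[OF Cons.prems] D_def[of u] D_def[of v]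
        V.scale_right_distrib)
qed

text \<open>The recursive counterpart of \<open>delta\<close>. The empty set gets weight 0
  explicitly, since \<open>n - 1\<close> truncates at 0; the exponent \<open>n - 1\<close> avoids
  division by \<open>lam\<close>.\<close>

definition dl :: "(('g \<times> 'g) list \<Rightarrow> 'g \<Rightarrow> 'v) \<Rightarrow> ('g \<times> 'g) list \<Rightarrow> 'g \<Rightarrow> 'v"
  where "dl F ps z = dins (\<lambda>n. if n = 0 then 0 else lam ^ (n - 1)) F ps z - dV (F ps z)"

lemma dl_Nil: "dl F [] z = F [] (d z) - dV (F [] z)"
  by (simp add: dl_def)

text \<open>Once an entry of the first pair is chosen, the remaining choices are free and weighted
  by powers of \<open>lam\<close>, so they sum to \<open>tr\<close>. Choosing both entries of the
  pair costs one further factor \<open>lam\<close>.\<close>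

lemma dl_Cons:
  assumes "form F"
  shows "dl F ((x, y) # ps) z = dl (\<lambda>qs. F ((x, y) # qs)) ps z + tr (\<lambda>qs. F ((d x, y) # qs)) ps z
    + tr (\<lambda>qs. F ((x, d y) # qs)) ps z + sv lam (tr (\<lambda>qs. F ((d x, d y) # qs)) ps z)"
  by (simp add: dl_def dins_scale_weight dins_power[OF form_Cons[OF assms]])

lemma dl_Cons_fun:
  assumes "form F"
  shows "(\<lambda>ps. dl F ((x, y) # ps)) = (\<lambda>ps z. dl (\<lambda>qs. F ((x, y) # qs)) ps z + tr (\<lambda>qs. F ((d x, y) # qs)) ps z
    + tr (\<lambda>qs. F ((x, d y) # qs)) ps z + sv lam (tr (\<lambda>qs. F ((d x, d y) # qs)) ps z))"
  by (simp add: fun_eq_iff dl_Cons[OF assms])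

lemma dl_diff: "dl (\<lambda>ps z. F ps z - F' ps z) ps z = dl F ps z - dl F' ps z"
  by (simp add: dl_def dins_diff dV_diff)

lemma dl_cong:
  "(\<And>qs. length qs = length ps \<Longrightarrow> F qs = F' qs) \<Longrightarrow> dl F ps z = dl F' ps z"
  unfolding dl_def using dins_cong[of ps F F'] by simp

lemma tr_Cons_fun: "(\<lambda>ps. tr F ((x, y) # ps)) = tr (\<lambda>qs. F ((D x, D y) # qs))"
  by (simp add: fun_eq_iff tr_def)

text \<open>Naturality: \<open>D\<close> preserves the bracket, and the modified action is
  \<open>rho\<close> after \<open>D\<close>.\<close>

lemma hat_lie_tr: "hat.lie x y (tr F) ps z = tr (lie (D x) (D y) F) ps z"
proof (induction ps arbitrary: F)
  case Nil
  show ?case by (simp only: hat.lie.simps) (simp add: tr_def rho_hat_eq D_br)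
next
  case (Cons p ps)
  obtain u v where p: "p = (u, v)" by (cases p)
  show ?case
    by (simp add: p tr_Cons_fun Cons.IH) (simp add: tr_def D_br)
qed

lemma hat_cob_tr: "hat.cob (tr F) ps z = tr (cob F) ps z"
proof (induction ps arbitrary: F)
  case Nil
  then show ?case by (simp add: tr_def)
next
  case (Cons p ps)
  obtain u v where p: "p = (u, v)" by (cases p)
  show ?case
  proof (cases "ps = []")
    case True
    show ?thesis
      by (simp only: p True hat.cob.simps hat.lie.simps) (simp add: tr_def rho_hat_eq D_br)
  next
    case False
    then show ?thesis
      by (simp add: p hat.cob_Cons hat_lie_tr tr_Cons_fun Cons.IH) (simp add: tr_def cob_Cons)
  qed
qed

definition dlie :: "'g \<Rightarrow> 'g \<Rightarrow> (('g \<times> 'g) list \<Rightarrow> 'g \<Rightarrow> 'v) \<Rightarrow> ('g \<times> 'g) list \<Rightarrow> 'g \<Rightarrow> 'v"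
  where "dlie x y F ps z = lie (d x) y F ps z + lie x (d y) F ps z + sv lam (lie (d x) (d y) F ps z)"

text \<open>The wedge of \<open>D x\<close> and \<open>D y\<close> is x \<and> y plus
  \<open>lam\<close> times \<Delta>(x \<and> y), and \<open>dlie\<close> is the Lie derivative along
  the latter.\<close>

lemma lie_D:
  assumes "form F"
  shows "lie (D x) (D y) F ps z = lie x y F ps z + sv lam (dlie x y F ps z)"
  by (simp add: dlie_def D_def altbilD(1-4)[OF lie_altbil[OF assms]] V.scale_right_distrib)

text \<open>Without pairs this is \<open>dV_rho'\<close> combined with \<open>d_br\<close>. In the
  inductive step the \<open>dl\<close> terms of both sides agree, and the \<open>tr\<close> terms
  are compared after expanding \<open>D\<close> on the first pair and applying
  \<open>d_br\<close>.\<close>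

lemma hat_lie_dl:
  assumes "form F"
  shows "hat.lie x y (dl F) ps z = dl (lie x y F) ps z + tr (dlie x y F) ps z"
  using assms
proof (induction ps arbitrary: F)
  case Nil
  note F = formD(2,3)[OF Nil]
  show ?case
    by (simp only: hat.lie.simps)
      (simp add: dl_Nil rho_hat_eq tr_def dlie_def F D_def rho_lin rho_diff br_lin dV_diff dV_rho' d_br
        V.scale_right_distrib V.scale_right_diff_distrib power2_eq_square)
next
  case (Cons p ps)
  obtain u v where p: "p = (u, v)" by (cases p)
  note F = Cons.prems
  have IH: "hat.lie x y (dl (\<lambda>qs. F (q # qs))) ps z =
      dl (lie x y (\<lambda>qs. F (q # qs))) ps z + tr (dlie x y (\<lambda>qs. F (q # qs))) ps z" for q
    using Cons.IH[OF form_Cons[OF F]] .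
  show ?case
    by (simp add: p dl_Cons_fun[OF F] dl_Cons[OF F] dl_Cons[OF form_lie[OF F]] hat.lie_add hat.lie_scale hat_lie_tr IH
        lie_Cons_fun dl_diff)
      (simp add: tr_def dlie_def lie_D[OF form_Cons[OF F]] D_def[of u] D_def[of v] form_lin[OF F]
        lie_in_form[OF F] lie_add lie_scale br_lin d_br V.scale_right_distrib V.scale_right_diff_distrib power2_eq_square)
qed

text \<open>Contract with X and use Cartan's formula: \<open>hat_lie_dl\<close> gives \<delta> L_X +
  T L_\<Delta>X, while induction and \<open>hat_cob_tr\<close> move the modified coboundary past
  \<delta> and T. The terms regroup by Cartan's formula for X and for \<Delta>X into the contraction
  of \<delta> \<partial> F. A single pair is computed directly.\<close>

lemma hat_cob_dl:
  assumes "form F"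
  shows "hat.cob (dl F) ps z = dl (cob F) ps z"
  using assms
proof (induction ps arbitrary: F)
  case Nil
  then show ?case by (simp add: dl_Nil)
next
  case (Cons p ps)
  obtain x y where p: "p = (x, y)" by (cases p)
  note F = Cons.prems
  have IH: "hat.cob (dl (\<lambda>qs. F (q # qs))) ps z = dl (cob (\<lambda>qs. F (q # qs))) ps z" for q
    using Cons.IH[OF form_Cons[OF F]] .
  show ?case
  proof (cases "ps = []")
    case True
    note lin = formD(2,3)[OF F]
    show ?thesis
      by (simp only: p True hat.cob.simps hat.lie.simps)
        (simp add: dl_Cons[OF form_cob[OF F]] dl_Nil rho_hat_eq tr_def lin D_def rho_lin rho_diff
          br_lin dV_lin dV_diff dV_rho' d_br V.scale_right_distrib V.scale_right_diff_distrib power2_eq_square)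
  next
    case False
    have "dl (\<lambda>qs. cob F ((x, y) # qs)) ps z =
        dl (\<lambda>qs z. lie x y F qs z - cob (\<lambda>qs. F ((x, y) # qs)) qs z) ps z"
      using False by (intro dl_cong ext cob_Cons) auto
    then have 1: "dl (\<lambda>qs. cob F ((x, y) # qs)) ps z =
        dl (lie x y F) ps z - dl (cob (\<lambda>qs. F ((x, y) # qs))) ps z"
      by (simp add: dl_diff)
    have 2: "tr (\<lambda>qs. cob F ((u, v) # qs)) ps z =
        tr (lie u v F) ps z - tr (cob (\<lambda>qs. F ((u, v) # qs))) ps z" for u v
      using False by (simp add: tr_def cob_Cons)
    show ?thesis
      using False
      by (simp add: p hat.cob_Cons hat_lie_dl[OF F] dl_Cons_fun[OF F] hat.cob_add hat.cob_scale
          hat_cob_tr IH dl_Cons[OF form_cob[OF F]] 1 2)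
        (simp add: tr_def dlie_def V.scale_right_diff_distrib)
  qed
qed

end

section \<open>The coboundary on decomposable arguments\<close>

lemma omit_Cons_0 [simp]: "omit 0 (x # xs) = xs"
  by (simp add: omit_def)

lemma omit_Cons_Suc [simp]: "omit (Suc i) (x # xs) = x # omit i xs"
  by (simp add: omit_def)

lemma omit_map: "omit i (map f xs) = map f (omit i xs)"
  by (simp add: omit_def take_map drop_map)

text \<open>Exhibits the replaced entry as one slot between a prefix and a suffix, where additivity
  of cochains applies.\<close>

lemma omit_list_update:
  assumes "i < j" "j < length xs"
  shows "omit i (xs[j := v]) = (take i xs @ drop (Suc i) (take j xs)) @ v # drop (Suc j) xs"
proof -
  have xs: "xs[j := v] = take j xs @ v # drop (Suc j) xs"
    using assms by (simp add: upd_conv_take_nth_drop)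
  show ?thesis
    using assms unfolding xs omit_def by (simp add: min_def)
qed

context exterior_forms
begin

lemma cochains_scale_fun:
  "f \<in> cochains sg sv p \<Longrightarrow> (\<lambda>Xs z. sv c (f Xs z)) \<in> cochains sg sv p"
  by (rule cochains_compose[where h = "sv c"]) (simp_all add: V.scale_right_distrib mult.commute)

lemma cochains_omit_update:
  assumes f: "f \<in> cochains sg sv p" and ij: "i < j" "j < length Xs" and Xs: "set Xs \<subseteq> ext_sq sg"
    and XY: "X \<in> ext_sq sg" "Y \<in> ext_sq sg"
  shows "f (omit i (Xs[j := ext_add sg X Y])) z = f (omit i (Xs[j := X])) z + f (omit i (Xs[j := Y])) z"
proof -
  have "set (take i Xs @ drop (Suc i) (take j Xs)) \<subseteq> ext_sq sg" "set (drop (Suc j) Xs) \<subseteq> ext_sq sg"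
    using Xs by (auto dest!: in_set_takeD in_set_dropD)
  then show ?thesis
    unfolding omit_list_update[OF ij] by (intro cochains_add[OF f] XY)
qed

end

text \<open>Splits off the terms with i = 0, which belong to the Lie derivative along the first
  pair.\<close>

lemma sum_triangle_shift:
  fixes h :: "nat \<Rightarrow> nat \<Rightarrow> 'a::comm_monoid_add"
  shows "(\<Sum>j<Suc m. \<Sum>i<j. h i j) = (\<Sum>j<m. h 0 (Suc j) + (\<Sum>i<j. h (Suc i) (Suc j)))"
  by (simp only: sum.lessThan_Suc_shift) simp

context three_lie_representation
begin

lemma lie_sum:
  "lie a b F ps z = rho a b (F ps z) - F ps (br a b z)
    - (\<Sum>j<length ps. F (ps[j := (fst (ps ! j), br a b (snd (ps ! j)))]) z
        + F (ps[j := (br a b (fst (ps ! j)), snd (ps ! j))]) z)"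
proof (induction ps arbitrary: F)
  case (Cons p ps)
  then show ?case
    by (cases p) (simp add: sum.lessThan_Suc_shift algebra_simps del: sum.lessThan_Suc)
qed simp

text \<open>The terms with i = 0 form the Lie derivative along the first pair, by
  \<open>lie_sum\<close>. In the others, shifting the index to the tail flips the sign, which is the
  minus sign in Cartan's formula.\<close>

lemma cob_sum:
  assumes "length ps = Suc n"
  shows "cob F ps z =
      (\<Sum>j<Suc n. \<Sum>i<j. sv ((-1) ^ (i + 1))
        (F (omit i (ps[j := (fst (ps ! j), br (fst (ps ! i)) (snd (ps ! i)) (snd (ps ! j)))])) z
        + F (omit i (ps[j := (br (fst (ps ! i)) (snd (ps ! i)) (fst (ps ! j)), snd (ps ! j))])) z))
    + (\<Sum>i<Suc n. sv ((-1) ^ (i + 1)) (F (omit i ps) (br (fst (ps ! i)) (snd (ps ! i)) z)))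
    + (\<Sum>i<Suc n. sv ((-1) ^ (i + 2)) (rho (fst (ps ! i)) (snd (ps ! i)) (F (omit i ps) z)))
    + sv ((-1) ^ (Suc n + 1)) (rho (snd (ps ! n)) z (F (butlast ps) (fst (ps ! n)))
        + rho z (fst (ps ! n)) (F (butlast ps) (snd (ps ! n))))"
  using assms
proof (induction n arbitrary: ps F)
  case 0
  then obtain x y where "ps = [(x, y)]" by (auto simp: length_Suc_conv)
  then show ?case by (simp add: omit_def)
next
  case (Suc n)
  then obtain x y qs where ps: "ps = (x, y) # qs" and len: "length qs = Suc n"
    by (metis length_Suc_conv surj_pair)
  have ne: "qs \<noteq> []" using len by auto
  show ?case
    unfolding ps cob_Cons[OF ne] lie_sum Suc.IH[OF len] len sum_triangle_shift[where m = "Suc n"]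
    unfolding sum.lessThan_Suc_shift[where n = "Suc n"]
    by (simp add: ne sum.distrib sum_negf sum_subtractf del: sum.lessThan_Suc)
qed

text \<open>Additivity of \<open>f\<close> splits \<open>bracket_F\<close> into its two wedges; then
  the defining sum is the one in \<open>cob_sum\<close>.\<close>

lemma cobd_eq_extend:
  assumes f: "f \<in> cochains sg sv p" and p: "1 \<le> p"
  shows "cobd sg br sv rho p f = extend sg sv (p + 1) (cob (on_pairs f))"
  unfolding cobd_def
proof (rule extend_cong)
  fix ps :: "('g \<times> 'g) list" and z
  assume "length ps = p + 1 - 1"
  then have len: "length ps = Suc (p - 1)" and lenp: "length ps = p" using p by simp_all
  let ?Xs = "wedges ps"
  have br: "f (omit i (?Xs[j := bracket_F sg br (ps ! i) (ps ! j)])) z =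
      on_pairs f (omit i (ps[j := (fst (ps ! j), br (fst (ps ! i)) (snd (ps ! i)) (snd (ps ! j)))])) z
      + on_pairs f (omit i (ps[j := (br (fst (ps ! i)) (snd (ps ! i)) (fst (ps ! j)), snd (ps ! j))])) z"
    if "i < j" "j < p" for i j
  proof -
    have 1: "bracket_F sg br (ps ! i) (ps ! j) =
        ext_add sg (wedge sg (fst (ps ! j)) (br (fst (ps ! i)) (snd (ps ! i)) (snd (ps ! j))))
          (wedge sg (br (fst (ps ! i)) (snd (ps ! i)) (fst (ps ! j))) (snd (ps ! j)))"
      by (simp add: bracket_F_def case_prod_beta)
    have 2: "on_pairs f (omit i (ps[j := (u, v)])) z = f (omit i (?Xs[j := wedge sg u v])) z" for u v
      by (simp add: on_pairs_def omit_map[symmetric] map_update)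
    show ?thesis
      unfolding 1 2 using that lenp by (intro cochains_omit_update[OF f] wedges_in_ext_sq) auto
  qed
  show "(let Xs = ?Xs; x = (\<lambda>i. fst (ps ! i)); y = (\<lambda>i. snd (ps ! i)) in
      (\<Sum>j<p. \<Sum>i<j. sv ((-1) ^ (i + 1)) (f (omit i (Xs[j := bracket_F sg br (ps ! i) (ps ! j)])) z))
    + (\<Sum>i<p. sv ((-1) ^ (i + 1)) (f (omit i Xs) (br (x i) (y i) z)))
    + (\<Sum>i<p. sv ((-1) ^ (i + 2)) (rho (x i) (y i) (f (omit i Xs) z)))
    + sv ((-1) ^ (p + 1))
        (rho (y (p - 1)) z (f (butlast Xs) (x (p - 1))) + rho z (x (p - 1)) (f (butlast Xs) (y (p - 1))))) =
    cob (on_pairs f) ps z"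
    unfolding Let_def cob_sum[OF len] using p
    by (simp add: br on_pairs_def omit_map map_butlast cong: sum.cong_simp del: sum.lessThan_Suc)
qed

lemma cobd_in_cochains:
  assumes "f \<in> cochains sg sv p" "1 \<le> p"
  shows "cobd sg br sv rho p f \<in> cochains sg sv (p + 1)"
  unfolding cobd_eq_extend[OF assms]
  by (intro extend_in_cochains form_cob form_on_pairs[OF assms(1)])

lemma on_pairs_cobd:
  assumes "f \<in> cochains sg sv p" "1 \<le> p" "length ps = p"
  shows "on_pairs (cobd sg br sv rho p f) ps z = cob (on_pairs f) ps z"
  unfolding cobd_eq_extend[OF assms(1,2)] on_pairs_def[of "extend _ _ _ _"]
  using assms(3) by (intro extend_wedges form_cob form_on_pairs[OF assms(1)]) simp

lemma cobd_cobd: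
  assumes f: "f \<in> cochains sg sv p" and p: "1 \<le> p"
  shows "cobd sg br sv rho (p + 1) (cobd sg br sv rho p f) = (\<lambda>_ _. 0)"
proof (rule cochains_eqI)
  note f' = cobd_in_cochains[OF f p]
  show "cobd sg br sv rho (p + 1) (cobd sg br sv rho p f) \<in> cochains sg sv (p + 2)"
    using cobd_in_cochains[OF f'] by simp
  show "(\<lambda>_ _. 0) \<in> cochains sg sv (p + 2)" by (rule cochains_0)
  fix ps :: "('g \<times> 'g) list" and z assume "length ps = p + 2 - 1"
  then have len: "length ps = p + 1" by simp
  have "on_pairs (cobd sg br sv rho (p + 1) (cobd sg br sv rho p f)) ps z =
      cob (on_pairs (cobd sg br sv rho p f)) ps z"
    using f' len by (intro on_pairs_cobd) auto
  \<comment> \<open>The formula for the inner coboundary holds on lists of length \<open>p\<close>,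
    which are the only ones entering the outer \<open>cob\<close> on \<open>p + 1\<close>
    pairs.\<close>
  also have "\<dots> = cob (cob (on_pairs f)) ps z"
    using len by (intro cob_cong ext on_pairs_cobd[OF f p]) auto
  also have "\<dots> = 0"
    by (rule cob_cob[OF form_on_pairs[OF f]])
  finally show "on_pairs (cobd sg br sv rho (p + 1) (cobd sg br sv rho p f)) ps z =
      on_pairs (\<lambda>_ _. 0) ps z"
    by (simp add: on_pairs_def)
qed

lemma cobd_plus:
  assumes f: "f \<in> cochains sg sv p" and g: "g \<in> cochains sg sv p" and p: "1 \<le> p"
  shows "cobd sg br sv rho p (\<lambda>Xs z. f Xs z + g Xs z) =
    (\<lambda>Xs z. cobd sg br sv rho p f Xs z + cobd sg br sv rho p g Xs z)"
proof (rule cochains_eqI)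
  fix ps :: "('g \<times> 'g) list" and z assume "length ps = p + 1 - 1"
  then have len: "length ps = p" by simp
  have "on_pairs (\<lambda>Xs z. f Xs z + g Xs z) = (\<lambda>ps z. on_pairs f ps z + on_pairs g ps z)"
    by (simp add: fun_eq_iff on_pairs_def)
  then show "on_pairs (cobd sg br sv rho p (\<lambda>Xs z. f Xs z + g Xs z)) ps z =
      on_pairs (\<lambda>Xs z. cobd sg br sv rho p f Xs z + cobd sg br sv rho p g Xs z) ps z"
    using on_pairs_cobd[OF cochains_plus[OF f g] p len, of z]
      on_pairs_cobd[OF f p len, of z] on_pairs_cobd[OF g p len, of z]
    by (simp add: cob_add on_pairs_def[of "\<lambda>Xs z. cobd _ _ _ _ _ _ Xs z + _ Xs z"]
        on_pairs_def[of "cobd _ _ _ _ _ _"])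
qed (intro cobd_in_cochains cochains_plus f g p)+

lemma cobd_scale:
  assumes f: "f \<in> cochains sg sv p" and p: "1 \<le> p"
  shows "cobd sg br sv rho p (\<lambda>Xs z. sv c (f Xs z)) = (\<lambda>Xs z. sv c (cobd sg br sv rho p f Xs z))"
proof (rule cochains_eqI)
  fix ps :: "('g \<times> 'g) list" and z assume "length ps = p + 1 - 1"
  then have len: "length ps = p" by simp
  have "on_pairs (\<lambda>Xs z. sv c (f Xs z)) = (\<lambda>ps z. sv c (on_pairs f ps z))"
    by (simp add: fun_eq_iff on_pairs_def)
  then show "on_pairs (cobd sg br sv rho p (\<lambda>Xs z. sv c (f Xs z))) ps z =
      on_pairs (\<lambda>Xs z. sv c (cobd sg br sv rho p f Xs z)) ps z"
    using on_pairs_cobd[OF cochains_scale_fun[OF f] p len, of c z] on_pairs_cobd[OF f p len, of z]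
    by (simp add: cob_scale on_pairs_def[of "\<lambda>Xs z. sv _ (cobd _ _ _ _ _ _ Xs z)"]
        on_pairs_def[of "cobd _ _ _ _ _ _"])
qed (intro cobd_in_cochains cochains_scale_fun f p)+

end

section \<open>The map \<open>\<delta>\<close> on decomposable arguments\<close>

text \<open>Sets are separated by whether they contain 0; the rest is renumbered. Used twice, it
  removes both entries of the first pair.\<close>

lemma sum_Pow_lessThan_Suc:
  fixes h :: "nat set \<Rightarrow> 'a::comm_monoid_add"
  shows "(\<Sum>S\<in>Pow {..<Suc m}. h S) =
    (\<Sum>S\<in>Pow {..<m}. h (Suc ` S)) + (\<Sum>S\<in>Pow {..<m}. h (insert 0 (Suc ` S)))"
proof -
  let ?P = "(`) Suc ` Pow {..<m}"
  have P: "Pow (Suc ` {..<m}) = ?P"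
    by (rule image_Pow_surj[OF refl, symmetric])
  have inj: "inj_on ((`) Suc) (Pow {..<m})"
    by (rule inj_onI) (simp add: inj_image_eq_iff)
  \<comment> \<open>No set in \<open>?P\<close> contains 0, so \<open>insert 0\<close> can be
    undone.\<close>
  have inj': "inj_on (insert 0) ?P"
    by (rule inj_onI) (auto dest: insert_ident[THEN iffD1, rotated 2])
  have "(\<Sum>S\<in>Pow {..<Suc m}. h S) = (\<Sum>S\<in>?P \<union> insert 0 ` ?P. h S)"
    unfolding lessThan_Suc_eq_insert_0 Pow_insert P ..
  also have "\<dots> = sum h ?P + sum h (insert 0 ` ?P)"
    by (rule sum.union_disjoint) auto
  finally show ?thesis
    by (simp add: sum.reindex[OF inj] sum.reindex[OF inj'] sum.reindex)
qed

context diff_three_lie_representation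
begin

lemma dins_sum:
  "dins c F ps z = (\<Sum>S\<in>Pow {..<2 * length ps + 1}. sv (c (card S))
    (let D = (\<lambda>i u. if i \<in> S then d u else u) in
      F (map (\<lambda>i. (D (2 * i) (fst (ps ! i)), D (2 * i + 1) (snd (ps ! i)))) [0..<length ps])
        (D (2 * length ps) z)))"
proof (induction ps arbitrary: c F)
  case Nil
  have "Pow {..<1::nat} = {{}, {0}}" by (auto simp: lessThan_Suc)
  then show ?case by simp
next
  case (Cons p ps)
  obtain x y where p: "p = (x, y)" by (cases p)
  have card: "card (Suc ` S) = card S" for S
    by (rule card_image) simp
  have fin: "finite S" if "S \<subseteq> {..<n}" for S and n :: nat
    using that finite_subset by blast
  have len: "2 * length (p # ps) + 1 = Suc (Suc (2 * length ps + 1))" by simp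
  have upt: "[0..<length (p # ps)] = 0 # map Suc [0..<length ps]"
    using upt_conv_Cons[of 0 "Suc (length ps)"] by (simp add: map_Suc_upt del: upt_Suc)
  show ?case
    unfolding p dins.simps Cons.IH
    unfolding len[unfolded p] upt[unfolded p] sum_Pow_lessThan_Suc
    by (simp add: Let_def o_def card card_insert_if fin image_iff add_ac cong: sum.cong_simp)
qed

text \<open>The indicator weight of \<open>k\<close> selects the sets of exactly \<open>k\<close>
  entries.\<close>

lemma insert_d_eq_extend:
  assumes f: "f \<in> cochains sg sv p" and p: "1 \<le> p"
  shows "insert_d sg sv d p k f = extend sg sv p (dins (\<lambda>n. of_bool (n = k)) (on_pairs f))"
  unfolding insert_d_def
proof (rule extend_cong)
  fix ps :: "('g \<times> 'g) list" and z
  assume len: "length ps = p - 1"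
  let ?h = "\<lambda>S. let D = (\<lambda>i u. if i \<in> S then d u else u) in
      f (map (\<lambda>i. wedge sg (D (2 * i) (fst (ps ! i))) (D (2 * i + 1) (snd (ps ! i)))) [0..<p - 1])
        (D (2 * p - 2) z)"
  have "2 * p - 1 = 2 * length ps + 1" "2 * p - 2 = 2 * length ps" using len p by simp_all
  then have "dins (\<lambda>n. of_bool (n = k)) (on_pairs f) ps z =
      (\<Sum>S\<in>Pow {..<2 * p - 1}. if card S = k then ?h S else 0)"
    unfolding dins_sum by (intro sum.cong) (simp_all add: len on_pairs_def Let_def o_def)
  also have "\<dots> = sum ?h {S \<in> Pow {..<2 * p - 1}. card S = k}"
    by (rule sum.inter_filter[symmetric]) simp
  finally show "(\<Sum>S | S \<subseteq> {..<2 * p - 1} \<and> card S = k. ?h S) =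
      dins (\<lambda>n. of_bool (n = k)) (on_pairs f) ps z"
    by simp
qed

lemma cochains_sum:
  "finite K \<Longrightarrow> (\<And>k. k \<in> K \<Longrightarrow> g k \<in> cochains sg sv p) \<Longrightarrow>
    (\<lambda>Xs z. \<Sum>k\<in>K. g k Xs z) \<in> cochains sg sv p"
  by (induction K rule: finite_induct) (simp_all add: cochains_0 cochains_plus)

lemma delta_in_cochains:
  assumes "f \<in> cochains sg sv p" "1 \<le> p"
  shows "delta sg lam d sv dV p f \<in> cochains sg sv p"
proof -
  have "insert_d sg sv d p k f \<in> cochains sg sv p" for k
    unfolding insert_d_eq_extend[OF assms]
    by (intro extend_in_cochains form_dins form_on_pairs[OF assms(1)])
  then have 1: "(\<lambda>Xs z. \<Sum>k = 1..2 * p - 1. sv (lam ^ (k - 1)) (insert_d sg sv d p k f Xs z)) \<in> cochains sg sv p"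
    by (intro cochains_sum cochains_scale_fun) simp_all
  have "(\<lambda>Xs z. - dV (f Xs z)) \<in> cochains sg sv p"
    by (rule cochains_compose[OF assms(1), where h = "\<lambda>v. - dV v"]) (simp_all add: dV_lin)
  from cochains_plus[OF 1 this] show ?thesis
    unfolding delta_def by simp
qed

lemma on_pairs_delta:
  assumes f: "f \<in> cochains sg sv p" "1 \<le> p" and len: "length ps = p - 1"
  shows "on_pairs (delta sg lam d sv dV p f) ps z = dl (on_pairs f) ps z"
proof -
  have "insert_d sg sv d p k f (wedges ps) z = dins (\<lambda>n. of_bool (n = k)) (on_pairs f) ps z" for k
    unfolding insert_d_eq_extend[OF f]
    by (intro extend_wedges form_dins form_on_pairs[OF f(1)] len)
  then have "(\<Sum>k = 1..2 * p - 1. sv (lam ^ (k - 1)) (insert_d sg sv d p k f (wedges ps) z)) =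
      dins (\<lambda>n. \<Sum>k = 1..2 * p - 1. lam ^ (k - 1) * of_bool (n = k)) (on_pairs f) ps z"
    by (simp only: dins_sum_weight finite_atLeastAtMost)
  \<comment> \<open>Only n up to \<open>2 * p - 1\<close> occur. For positive n the sum reduces to k
    = n; for n = 0 it is zero, since k starts at 1.\<close>
  also have "\<dots> = dins (\<lambda>n. if n = 0 then 0 else lam ^ (n - 1)) (on_pairs f) ps z"
    using len f(2) by (intro dins_cong_weight) (auto simp: of_bool_def if_distrib cong: if_cong)
  finally show ?thesis
    by (simp add: on_pairs_def delta_def dl_def)
qed

lemma cobd_delta:
  assumes f: "f \<in> cochains sg sv p" and p: "1 \<le> p"
  shows "cobd sg br sv (rho_hat sv lam d rho) p (delta sg lam d sv dV p f) =
    delta sg lam d sv dV (p + 1) (cobd sg br sv rho p f)"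
proof (rule cochains_eqI)
  note df = delta_in_cochains[OF f p] and cf = cobd_in_cochains[OF f p]
  show "cobd sg br sv (rho_hat sv lam d rho) p (delta sg lam d sv dV p f) \<in> cochains sg sv (p + 1)"
    by (rule hat.cobd_in_cochains[OF df p])
  show "delta sg lam d sv dV (p + 1) (cobd sg br sv rho p f) \<in> cochains sg sv (p + 1)"
    by (rule delta_in_cochains[OF cf]) simp
  fix ps :: "('g \<times> 'g) list" and z assume "length ps = p + 1 - 1"
  then have len: "length ps = p" by simp
  have "on_pairs (cobd sg br sv (rho_hat sv lam d rho) p (delta sg lam d sv dV p f)) ps z =
      hat.cob (on_pairs (delta sg lam d sv dV p f)) ps z"
    by (rule hat.on_pairs_cobd[OF df p len])
  also have "\<dots> = hat.cob (dl (on_pairs f)) ps z"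
    using len by (intro hat.cob_cong ext on_pairs_delta[OF f p]) auto
  also have "\<dots> = dl (cob (on_pairs f)) ps z"
    by (rule hat_cob_dl[OF form_on_pairs[OF f]])
  also have "\<dots> = dl (on_pairs (cobd sg br sv rho p f)) ps z"
    using len by (intro dl_cong ext on_pairs_cobd[OF f p, symmetric]) auto
  also have "\<dots> = on_pairs (delta sg lam d sv dV (p + 1) (cobd sg br sv rho p f)) ps z"
    using len by (intro on_pairs_delta[OF cf, symmetric]) auto
  finally show "on_pairs (cobd sg br sv (rho_hat sv lam d rho) p (delta sg lam d sv dV p f)) ps z =
      on_pairs (delta sg lam d sv dV (p + 1) (cobd sg br sv rho p f)) ps z" .
qed

end

section \<open>The coboundary of the full complex\<close>

theorem theorem3p4:
  fixes sg :: "'k::field_char_0 \<Rightarrow> 'g::ab_group_add \<Rightarrow> 'g"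
    and br :: "'g \<Rightarrow> 'g \<Rightarrow> 'g \<Rightarrow> 'g"
    and lam :: 'k
    and d :: "'g \<Rightarrow> 'g"
    and sv :: "'k \<Rightarrow> 'v::ab_group_add \<Rightarrow> 'v"
    and rho :: "'g \<Rightarrow> 'g \<Rightarrow> 'v \<Rightarrow> 'v"
    and dV :: "'v \<Rightarrow> 'v"
  assumes "diff_three_lie_algebra sg br lam d"
    and "diff_three_lie_representation sg br lam d sv rho dV"
  shows "(\<forall>f \<in> cochains sg sv 1.
        diff_cobd1 sg br lam d sv rho dV f \<in> diff_cochains sg sv 2 \<and>
        diff_cobd sg br lam d sv rho dV 2 (diff_cobd1 sg br lam d sv rho dV f) =
          (\<lambda>_ _. 0, \<lambda>_ _. 0))
    \<and> (\<forall>p \<ge> 2. \<forall>c \<in> diff_cochains sg sv p.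
        diff_cobd sg br lam d sv rho dV p c \<in> diff_cochains sg sv (p + 1) \<and>
        diff_cobd sg br lam d sv rho dV (p + 1) (diff_cobd sg br lam d sv rho dV p c) =
          (\<lambda>_ _. 0, \<lambda>_ _. 0))"
proof -
  interpret diff_three_lie_representation sg br lam d sv rho dV
    by (rule assms(2))
  let ?b = "cobd sg br sv rho" and ?bh = "cobd sg br sv (rho_hat sv lam d rho)"
    and ?dl = "delta sg lam d sv dV"
  have deg1: "diff_cobd1 sg br lam d sv rho dV f \<in> diff_cochains sg sv 2 \<and>
      diff_cobd sg br lam d sv rho dV 2 (diff_cobd1 sg br lam d sv rho dV f) = (\<lambda>_ _. 0, \<lambda>_ _. 0)"
    if f: "f \<in> cochains sg sv 1" for f
  proof -
    have minus: "(\<lambda>Xs z. - ?dl 1 f Xs z) = (\<lambda>Xs z. sv (- 1) (?dl 1 f Xs z))"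
      by simp
    have "?b 1 f \<in> cochains sg sv 2"
      by (rule cobd_in_cochains[OF f order_refl, unfolded one_add_one])
    moreover have "(\<lambda>Xs z. - ?dl 1 f Xs z) \<in> cochains sg sv 1"
      unfolding minus by (intro cochains_scale_fun delta_in_cochains[OF f]) simp
    moreover have "?b 2 (?b 1 f) = (\<lambda>_ _. 0)"
      by (rule cobd_cobd[OF f order_refl, unfolded one_add_one])
    moreover have "?bh 1 (\<lambda>Xs z. - ?dl 1 f Xs z) = (\<lambda>Xs z. - ?dl 2 (?b 1 f) Xs z)"
      unfolding minus hat.cobd_scale[OF delta_in_cochains[OF f order_refl] order_refl]
        cobd_delta[OF f order_refl, unfolded one_add_one]
      by simp
    ultimately show ?thesis
      by (simp add: diff_cobd1_def diff_cobd_def diff_cochains_def)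
  qed
  have deg_ge2: "diff_cobd sg br lam d sv rho dV p (f, g) \<in> diff_cochains sg sv (p + 1) \<and>
      diff_cobd sg br lam d sv rho dV (p + 1) (diff_cobd sg br lam d sv rho dV p (f, g)) =
        (\<lambda>_ _. 0, \<lambda>_ _. 0)"
    if p: "2 \<le> p" and f: "f \<in> cochains sg sv p" and g: "g \<in> cochains sg sv (p - 1)" for p f g
  proof -
    \<comment> \<open>The second component has degree \<open>p - 1\<close>, and the results on
      cochains apply to it because this degree is at least 1.\<close>
    have p1: "1 \<le> p" "1 \<le> p - 1" "p - 1 + 1 = p"
      using p by simp_all
    note cg = hat.cobd_in_cochains[OF g p1(2), unfolded p1(3)]
      and df = cochains_scale_fun[OF delta_in_cochains[OF f p1(1)], of "(- 1) ^ p"]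
    \<comment> \<open>The square of the modified coboundary kills \<open>g\<close>, and
      \<open>cobd_delta\<close> turns the rest into (-1)^p \<delta> \<partial> f. The second
      application contributes the same term with sign (-1)^(p+1), so the two cancel.\<close>
    have "?bh p (\<lambda>Xs z. ?bh (p - 1) g Xs z + sv ((- 1) ^ p) (?dl p f Xs z)) =
        (\<lambda>Xs z. sv ((- 1) ^ p) (?dl (p + 1) (?b p f) Xs z))"
      using hat.cobd_cobd[OF g p1(2)]
      by (simp only: hat.cobd_plus[OF cg df p1(1)] p1(3)
          hat.cobd_scale[OF delta_in_cochains[OF f p1(1)] p1(1)] cobd_delta[OF f p1(1)]) simp
    then show ?thesis
      using cobd_in_cochains[OF f p1(1)] cobd_cobd[OF f p1(1)] cochains_plus[OF cg df]
      by (simp add: diff_cobd_def diff_cochains_def)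
  qed
  show ?thesis
    using deg1 deg_ge2 by (auto simp: diff_cochains_def simp del: One_nat_def)
qed

end
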